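(* Let $\alpha:\Gamma\curvearrowright X$ be a minimal free action of a countable discrete amenable group $\Gamma$ on a compact metrizable space $X$, and let $X\rtimes_\alpha\Gamma$ be its transformation groupoid. Then $X\rtimes_\alpha\Gamma$ is fiberwise amenable and almost elementary if and only if $\alpha$ is almost finite in Kerr's sense.
   Context: The transformation groupoid is $X\rtimes_\alpha\Gamma=\{(\gamma x,\gamma,x)\}$ with $s(\gamma x,\gamma,x)=x$, $r=\gamma x$, $(\gamma\beta y,\gamma,\beta y)(\beta y,\beta,y)=(\gamma\beta y,\gamma\beta,y)$, topologized as a subset of $X\times\Gamma\times X$. For an étale groupoid $\mathcal G$, $AB=\{xy:x\in A,y\in B,s(x)=r(y)\}$; for $K,F\subseteq\mathcal G$ the $K$-boundary is $\partial_KF=(KF\setminus F)\cup\{x\in F:yx\notin F\text{ for some }y\in K\text{ with }s(y)=r(x)\}$; $\mathcal G$ is fiberwise amenable if for every compact $K\subseteq\mathcal G$ and $\varepsilon>0$ there is a finite nonempty $F\subseteq\mathcal G$ with $|\partial_KF|\le\varepsilon|F|$. Bisection, multisection, castle, $K$-extendable, $\prec_{\mathcal G}$ and almost elementary: a multisection is a finite family $\{C_{i,j}:i,j\in F\}$ of bisections with $C_{i,j}C_{j,k}=C_{i,k}$ and pairwise disjoint levels $C_{i,i}\subseteq\mathcal G^{(0)}$; a castle is a finite family $\{C^l_{i,j}:i,j\in F_l,l\in I\}$ of multisections with $C^l_{i,j}C^{l'}_{i',j'}=\emptyset$ for $l\neq l'$; $\mathcal C$ is $K$-extendable to $\mathcal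 D=\{D^l_{i,j}:i,j\in E_l,l\in I\}$ if $F_l\subseteq E_l$, $C^l_{i,j}=D^l_{i,j}$ for $i,j\in F_l$, and $K\cdot\bigcup\mathcal C\subseteq\bigcup\mathcal D$; $K\prec_{\mathcal G}V$ means there are open bisections $A_1,\dots,A_n$ with $K\subseteq\bigcup s(A_i)$ and $r(A_i)$ pairwise disjoint subsets of $V$; $\mathcal G$ is almost elementary if for every compact $K\supseteq\mathcal G^{(0)}$, nonempty open $O\subseteq\mathcal G^{(0)}$ and open cover $\mathcal V$ there are open castles $\mathcal C,\mathcal D$ with $\mathcal C$ $K$-extendable to $\mathcal D$, all levels of $\mathcal D$ inside members of $\mathcal V$, and $\mathcal G^{(0)}\setminus\bigcup(\text{levels of }\mathcal C)\prec_{\mathcal G}O$. For the action we write $\prec_\alpha$ for $\prec_{X\rtimes_\alpha\Gamma}$. Kerr's almost finiteness: a tower is a pair $(S,V)$ with $S\subseteq\Gamma$ finite, $V\subseteq X$, $\{sV:s\in S\}$ pairwise disjoint; a castle of towers $\{(S_i,V_i)\}_{i\in I}$ requires $sV_i\cap tV_j=\emptyset$ for $s\in S_i,t\in S_j$, $i\ne j$; open if all $V_i$ open. $\alpha$ is almost finite if for every $n\in\mathbb N$, finite $K\subseteq\Gamma$ and $\delta>0$ there are an open castle $\{(S_i,V_i)\}_{i\in I}$ with each $S_i$ $(K,\delta)$-invariant ($|\bigcap_{t\in K}t^{-1}S_i|\ge(1-\delta)|S_i|$) and all levels $sV_i$ of diameter $<\delta$, and sets $S_i'\subseteq S_i$ with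 $|S_i'|<|S_i|/n$ and $X\setminus\bigsqcup_iS_iV_i\prec_\alpha\bigsqcup_iS_i'V_i$. *)

theory Defs
  imports "HOL-Analysis.Analysis"
begin

record 'a groupoid =
  gcarrier :: "'a set"
  gsrc :: "'a \<Rightarrow> 'a"
  grng :: "'a \<Rightarrow> 'a"
  gmult :: "'a \<Rightarrow> 'a \<Rightarrow> 'a"
  gtop :: "'a topology"

definition gunits :: "'a groupoid \<Rightarrow> 'a set" where
  "gunits \<G> = gsrc \<G> ` gcarrier \<G>"

definition gsetprod :: "'a groupoid \<Rightarrow> 'a set \<Rightarrow> 'a set \<Rightarrow> 'a set" where
  "gsetprod \<G> A B = {gmult \<G> x y | x y. x \<in> A \<and> y \<in> B \<and> gsrc \<G> x = grng \<G> y}"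

definition gboundary :: "'a groupoid \<Rightarrow> 'a set \<Rightarrow> 'a set \<Rightarrow> 'a set" where
  "gboundary \<G> K F = (gsetprod \<G> K F - F) \<union>
     {x \<in> F. \<exists>y \<in> K. gsrc \<G> y = grng \<G> x \<and> gmult \<G> y x \<notin> F}"

definition fiberwise_amenable :: "'a groupoid \<Rightarrow> bool" where
  "fiberwise_amenable \<G> \<longleftrightarrow>
     (\<forall>K. K \<subseteq> gcarrier \<G> \<and> compactin (gtop \<G>) K \<longrightarrow>
       (\<forall>\<epsilon>>0. \<exists>F. F \<subseteq> gcarrier \<G> \<and> finite F \<and> F \<noteq> {} \<and>
          real (card (gboundary \<G> K F)) \<le> \<epsilon> * real (card F)))"

definition bisection :: "'a groupoid \<Rightarrow> 'a set \<Rightarrow> bool" where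
  "bisection \<G> B \<longleftrightarrow> B \<subseteq> gcarrier \<G> \<and> inj_on (gsrc \<G>) B \<and> inj_on (grng \<G>) B"

definition open_bisection :: "'a groupoid \<Rightarrow> 'a set \<Rightarrow> bool" where
  "open_bisection \<G> B \<longleftrightarrow> bisection \<G> B \<and> openin (gtop \<G>) B"

definition multisection :: "'a groupoid \<Rightarrow> nat set \<Rightarrow> (nat \<Rightarrow> nat \<Rightarrow> 'a set) \<Rightarrow> bool" where
  "multisection \<G> F C \<longleftrightarrow> finite F \<and>
     (\<forall>i\<in>F. \<forall>j\<in>F. bisection \<G> (C i j)) \<and>
     (\<forall>i\<in>F. \<forall>j\<in>F. \<forall>k\<in>F. gsetprod \<G> (C i j) (C j k) = C i k) \<and>
     (\<forall>i\<in>F. C i i \<subseteq> gunits \<G>) \<and>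
     (\<forall>i\<in>F. \<forall>j\<in>F. i \<noteq> j \<longrightarrow> C i i \<inter> C j j = {})"

definition castle :: "'a groupoid \<Rightarrow> nat set \<Rightarrow> (nat \<Rightarrow> nat set) \<Rightarrow> (nat \<Rightarrow> nat \<Rightarrow> nat \<Rightarrow> 'a set) \<Rightarrow> bool" where
  "castle \<G> I F C \<longleftrightarrow> finite I \<and>
     (\<forall>l\<in>I. multisection \<G> (F l) (C l)) \<and>
     (\<forall>l\<in>I. \<forall>l'\<in>I. l \<noteq> l' \<longrightarrow>
        (\<forall>i\<in>F l. \<forall>j\<in>F l. \<forall>i'\<in>F l'. \<forall>j'\<in>F l'. gsetprod \<G> (C l i j) (C l' i' j') = {}))"

definition open_castle :: "'a groupoid \<Rightarrow> nat set \<Rightarrow> (nat \<Rightarrow> nat set) \<Rightarrow> (nat \<Rightarrow> nat \<Rightarrow> nat \<Rightarrow> 'a set) \<Rightarrow> bool" where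
  "open_castle \<G> I F C \<longleftrightarrow> castle \<G> I F C \<and>
     (\<forall>l\<in>I. \<forall>i\<in>F l. \<forall>j\<in>F l. openin (gtop \<G>) (C l i j))"

definition castle_union :: "nat set \<Rightarrow> (nat \<Rightarrow> nat set) \<Rightarrow> (nat \<Rightarrow> nat \<Rightarrow> nat \<Rightarrow> 'a set) \<Rightarrow> 'a set" where
  "castle_union I F C = (\<Union>l\<in>I. \<Union>i\<in>F l. \<Union>j\<in>F l. C l i j)"

definition castle_levels :: "nat set \<Rightarrow> (nat \<Rightarrow> nat set) \<Rightarrow> (nat \<Rightarrow> nat \<Rightarrow> nat \<Rightarrow> 'a set) \<Rightarrow> 'a set" where
  "castle_levels I F C = (\<Union>l\<in>I. \<Union>i\<in>F l. C l i i)"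

definition extendable :: "'a groupoid \<Rightarrow> 'a set \<Rightarrow> nat set \<Rightarrow> (nat \<Rightarrow> nat set) \<Rightarrow> (nat \<Rightarrow> nat \<Rightarrow> nat \<Rightarrow> 'a set)
    \<Rightarrow> (nat \<Rightarrow> nat set) \<Rightarrow> (nat \<Rightarrow> nat \<Rightarrow> nat \<Rightarrow> 'a set) \<Rightarrow> bool" where
  "extendable \<G> K I F C E D \<longleftrightarrow>
     (\<forall>l\<in>I. F l \<subseteq> E l \<and> (\<forall>i\<in>F l. \<forall>j\<in>F l. C l i j = D l i j)) \<and>
     gsetprod \<G> K (castle_union I F C) \<subseteq> castle_union I E D"

definition gsubeq :: "'a groupoid \<Rightarrow> 'a set \<Rightarrow> 'a set \<Rightarrow> bool" where
  "gsubeq \<G> K V \<longleftrightarrow> (\<exists>(n::nat) A.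
     (\<forall>i<n. open_bisection \<G> (A i)) \<and>
     K \<subseteq> (\<Union>i<n. gsrc \<G> ` A i) \<and>
     (\<forall>i<n. grng \<G> ` A i \<subseteq> V) \<and>
     (\<forall>i<n. \<forall>j<n. i \<noteq> j \<longrightarrow> grng \<G> ` A i \<inter> grng \<G> ` A j = {}))"

definition almost_elementary :: "'a groupoid \<Rightarrow> bool" where
  "almost_elementary \<G> \<longleftrightarrow>
     (\<forall>K U \<V>. compactin (gtop \<G>) K \<and> gunits \<G> \<subseteq> K \<and>
        openin (gtop \<G>) U \<and> U \<subseteq> gunits \<G> \<and> U \<noteq> {} \<and>
        (\<forall>V\<in>\<V>. openin (gtop \<G>) V \<and> V \<subseteq> gunits \<G>) \<and> gunits \<G> \<subseteq> \<Union>\<V> \<longrightarrow>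
        (\<exists>I F C E D. open_castle \<G> I F C \<and> open_castle \<G> I E D \<and>
           extendable \<G> K I F C E D \<and>
           (\<forall>l\<in>I. \<forall>i\<in>E l. \<exists>V\<in>\<V>. D l i i \<subseteq> V) \<and>
           gsubeq \<G> (gunits \<G> - castle_levels I F C) U))"

text \<open>The (discrete) group \<Gamma> is the type 'g (written additively, not necessarily
  commutative); X is the type 'x, a metric space.\<close>

definition group_action :: "('g::group_add \<Rightarrow> 'x::topological_space \<Rightarrow> 'x) \<Rightarrow> bool" where
  "group_action \<alpha> \<longleftrightarrow> (\<forall>x. \<alpha> 0 x = x) \<and> (\<forall>g h x. \<alpha> (g + h) x = \<alpha> g (\<alpha> h x)) \<and>
     (\<forall>g. continuous_on UNIV (\<alpha> g))"

definition free_action :: "('g::group_add \<Rightarrow> 'x \<Rightarrow> 'x) \<Rightarrow> bool" where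
  "free_action \<alpha> \<longleftrightarrow> (\<forall>g x. \<alpha> g x = x \<longrightarrow> g = 0)"

definition minimal_action :: "('g::group_add \<Rightarrow> 'x::topological_space \<Rightarrow> 'x) \<Rightarrow> bool" where
  "minimal_action \<alpha> \<longleftrightarrow> (\<forall>Y. closed Y \<and> (\<forall>g. \<alpha> g ` Y \<subseteq> Y) \<longrightarrow> Y = {} \<or> Y = UNIV)"

definition amenable_group :: "'g::group_add itself \<Rightarrow> bool" where
  "amenable_group _ \<longleftrightarrow> (\<exists>\<mu> :: 'g set \<Rightarrow> real.
     \<mu> UNIV = 1 \<and> (\<forall>A. 0 \<le> \<mu> A) \<and>
     (\<forall>A B. A \<inter> B = {} \<longrightarrow> \<mu> (A \<union> B) = \<mu> A + \<mu> B) \<and>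
     (\<forall>g A. \<mu> ((\<lambda>h. g + h) ` A) = \<mu> A))"

definition transformation_groupoid :: "('g::group_add \<Rightarrow> 'x::topological_space \<Rightarrow> 'x) \<Rightarrow> ('x \<times> 'g \<times> 'x) groupoid" where
  "transformation_groupoid \<alpha> =
     \<lparr> gcarrier = {(\<alpha> g x, g, x) | g x. True},
       gsrc = (\<lambda>(y, g, x). (x, 0, x)),
       grng = (\<lambda>(y, g, x). (y, 0, y)),
       gmult = (\<lambda>(z, g, y) (y', h, x). (z, g + h, x)),
       gtop = subtopology (prod_topology euclidean (prod_topology (discrete_topology UNIV) euclidean))
                {(\<alpha> g x, g, x) | g x. True} \<rparr>"

definition unit_emb :: "'x set \<Rightarrow> ('x \<times> 'g::group_add \<times> 'x) set" where
  "unit_emb Y = (\<lambda>x. (x, 0, x)) ` Y"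

definition tower_castle :: "('g::group_add \<Rightarrow> 'x \<Rightarrow> 'x) \<Rightarrow> nat set \<Rightarrow> (nat \<Rightarrow> 'g set) \<Rightarrow> (nat \<Rightarrow> 'x set) \<Rightarrow> bool" where
  "tower_castle \<alpha> I S V \<longleftrightarrow> finite I \<and>
     (\<forall>i\<in>I. finite (S i) \<and> (\<forall>s\<in>S i. \<forall>t\<in>S i. s \<noteq> t \<longrightarrow> \<alpha> s ` V i \<inter> \<alpha> t ` V i = {})) \<and>
     (\<forall>i\<in>I. \<forall>j\<in>I. i \<noteq> j \<longrightarrow> (\<forall>s\<in>S i. \<forall>t\<in>S j. \<alpha> s ` V i \<inter> \<alpha> t ` V j = {}))"

text \<open>(K,\<delta>)-invariance: |\<Inter>_{t\<in>K} t\<inverse>S| \<ge> (1-\<delta>)|S|. The intersection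
  \<Inter>_{t\<in>K} t\<inverse>S = {s. \<forall>t\<in>K. ts \<in> S} is infinite only when K = {} and \<Gamma> is infinite, in
  which case the inequality holds trivially (infinite cardinality).\<close>
definition invariant_set :: "'g::group_add set \<Rightarrow> real \<Rightarrow> 'g set \<Rightarrow> bool" where
  "invariant_set K \<delta> S \<longleftrightarrow>
     (let A = {s. \<forall>t\<in>K. t + s \<in> S} in infinite A \<or> real (card A) \<ge> (1 - \<delta>) * real (card S))"

definition almost_finite :: "('g::group_add \<Rightarrow> 'x::metric_space \<Rightarrow> 'x) \<Rightarrow> bool" where
  "almost_finite \<alpha> \<longleftrightarrow>
     (\<forall>(n::nat) K \<delta>. n \<ge> 1 \<and> finite K \<and> \<delta> > 0 \<longrightarrow>
        (\<exists>I S V S'. tower_castle \<alpha> I S V \<and> (\<forall>i\<in>I. open (V i)) \<and>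
           (\<forall>i\<in>I. invariant_set K \<delta> (S i)) \<and>
           (\<forall>i\<in>I. \<forall>s\<in>S i. diameter (\<alpha> s ` V i) < \<delta>) \<and>
           (\<forall>i\<in>I. S' i \<subseteq> S i \<and> real (card (S' i)) < real (card (S i)) / real n) \<and>
           gsubeq (transformation_groupoid \<alpha>)
             (unit_emb (UNIV - (\<Union>i\<in>I. \<Union>s\<in>S i. \<alpha> s ` V i)))
             (unit_emb (\<Union>i\<in>I. \<Union>s\<in>S' i. \<alpha> s ` V i))))"

end

theory Submission
  imports Defs
begin

text \<open>
  Fiberwise amenability of the groupoid yields Folner sets in the group, by pigeonhole over the source
  fibres. Given Folner sets, every finite M lies in an almost invariant T with
  \<open>M \<subseteq> T \<subseteq> L + M\<close>, where L does not depend on M. Applied to the shapes of the two castles of almost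
  elementariness, this gives a castle of almost invariant towers whose remainder R is
  subequivalent to a prescribed small open set U.

  For almost finiteness, R must be moved into few levels of these same towers. If U has many disjoint
  translates, orbits visit R much less often than the chosen levels. Take a second castle of towers,
  fine enough to see this on each of its levels, with remainder subequivalent to one reserved level of
  the first castle. It has at least as many levels inside the chosen ones as levels meeting R.

  Conversely, few elements of an almost invariant shape leave it under translation by K, whereas by
  minimality every tower has a positive proportion of its levels inside a given open set. So the
  levels missing from the inner castle, and the remainder, fit there.
\<close>

section \<open>Almost invariant finite subsets of a group\<close>

text \<open>Almost elementariness says nothing about invariance of shapes: it only yields an inner
  shape M and an outer one containing L + M. As L must be fixed before the castle is known, one L
  has to serve all M. For almost finiteness, R is replaced by the open set N that its subequivalence
  already carries into U. The levels of the first castle and N cover X, and a Lebesgue number of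
  this cover puts each level of the second castle inside a level of the first or inside N. The
  second castle leaves a remainder of its own, which would restart the problem; the reserved level
  ends this regress. All comparisons are made tower by tower, since levels of one tower are
  translates of each other and can be exchanged. Finite groups are a separate case, because the
  count needs many disjoint translates of a nonempty open set.\<close>

definition folner_condition :: "'g::group_add itself \<Rightarrow> bool" where
  "folner_condition _ \<longleftrightarrow> (\<forall>(K::'g set) \<epsilon>. finite K \<and> \<epsilon> > (0::real) \<longrightarrow>
     (\<exists>F. finite F \<and> F \<noteq> {} \<and> real (card (K + F)) \<le> (1 + \<epsilon>) * real (card F)))"

lemma subset_set_plus_left:
  fixes A :: "'g::group_add set"
  assumes "0 \<in> K"
  shows "A \<subseteq> K + A"
  using assms set_plus_intro by fastforce

lemma set_plus_singleton_right: "A + {b} = (\<lambda>a. a + b) ` A"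
  by (auto simp: set_plus_def)

lemma card_set_plus_singleton_right:
  fixes b :: "'g::group_add"
  shows "card (A + {b}) = card A"
  unfolding set_plus_singleton_right by (intro card_image inj_onI) simp

lemma card_set_plus_le:
  assumes "finite A" "finite B"
  shows "card (A + B) \<le> card A * card B"
proof -
  have "A + B = (\<lambda>(a, b). a + b) ` (A \<times> B)"
    by (auto simp: set_plus_def)
  then show ?thesis
    using card_image_le[of "A \<times> B" "\<lambda>(a, b). a + b"] assms by (simp add: card_cartesian_product)
qed

lemma card_set_plus_right_le:
  fixes A :: "'g::group_add set"
  assumes "finite A" "finite B" "B \<noteq> {}"
  shows "card A \<le> card (A + B)"
proof -
  obtain b where "b \<in> B" using assms by blast
  then have "A + {b} \<subseteq> A + B" by (intro set_plus_mono2) auto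
  then show ?thesis
    using card_mono[of "A + B" "A + {b}"] assms by (simp add: card_set_plus_singleton_right finite_set_plus)
qed

text \<open>A subfamily of the translates of F that is maximal among the half-disjoint ones
  meets every translate in at least half of it.\<close>
lemma half_disjoint_translates:
  fixes F B :: "'g::group_add set"
  assumes "finite F" "F \<noteq> {}" "finite B"
  obtains B' where "B' \<subseteq> B" "card B' * card F \<le> 2 * card (F + B')" "card B \<le> 2 * card (F + B')"
proof -
  let ?ok = "\<lambda>B'. B' \<subseteq> B \<and> card B' * card F \<le> 2 * card (F + B')"
  have "\<exists>B'. ?ok B' \<and> (\<forall>B''. ?ok B'' \<longrightarrow> card B'' \<le> card B')"
  proof (rule ex_has_greatest_nat[where b = "Suc (card B)"])
    show "?ok {}" by simp
    show "\<forall>y. ?ok y \<longrightarrow> card y < Suc (card B)" using card_mono[OF assms(3)] by (simp add: less_Suc_eq_le)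
  qed
  then obtain B' where B': "?ok B'" and max: "\<And>B''. ?ok B'' \<Longrightarrow> card B'' \<le> card B'"
    by blast
  define A where "A = F + B'"
  have finB': "finite B'" using B' assms(3) finite_subset by blast
  have finA: "finite A" unfolding A_def using finB' assms(1) by (intro finite_set_plus)
  have half: "card F \<le> 2 * card {f\<in>F. f + b \<in> A}" if "b \<in> B" for b
  proof (cases "b \<in> B'")
    case True
    then have "{f\<in>F. f + b \<in> A} = F" by (auto simp: A_def intro: set_plus_intro)
    then show ?thesis by simp
  next
    case False
    show ?thesis
    proof (rule ccontr)
      assume neg: "\<not> ?thesis"
      \<comment> \<open>If less than half of F + b lay in A, adding b would contribute more than
        |F|/2 new elements, and the larger family would still be half-disjoint, against
        maximality.\<close>
      let ?N = "(\<lambda>f. f + b) ` {f\<in>F. f + b \<notin> A}"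
      have "F + insert b B' = A \<union> (\<lambda>f. f + b) ` F"
        by (auto simp: A_def set_plus_def)
      also have "\<dots> = A \<union> ?N" by blast
      finally have "F + insert b B' = A \<union> ?N" .
      moreover have "A \<inter> ?N = {}" by auto
      moreover have "card ?N = card {f\<in>F. f + b \<notin> A}"
        by (intro card_image inj_onI) simp
      ultimately have "card (F + insert b B') = card A + card {f\<in>F. f + b \<notin> A}"
        using finA assms(1) by (simp add: card_Un_disjoint)
      moreover have "card F = card {f\<in>F. f + b \<in> A} + card {f\<in>F. f + b \<notin> A}"
        using assms(1) by (subst card_Un_disjoint[symmetric]) (auto intro: arg_cong[where f=card])
      ultimately have "card (insert b B') * card F \<le> 2 * card (F + insert b B')"
        using B' neg False finB' by (simp add: A_def)
      then have "?ok (insert b B')" using B' that by blast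
      then show False using max[of "insert b B'"] False finB' by simp
    qed
  qed
  \<comment> \<open>Double counting of the pairs (b, f) with f + b in A: at least |B||F|/2 by
    \<open>half\<close>, at most |F||A| because f and f + b determine b.\<close>
  let ?S = "Sigma B (\<lambda>b. {f\<in>F. f + b \<in> A})"
  have "card ?S \<le> card (F \<times> A)"
    by (rule card_inj_on_le[of "\<lambda>(b, f). (f, f + b)"]) (auto simp: inj_on_def finA assms)
  moreover have "card ?S = (\<Sum>b\<in>B. card {f\<in>F. f + b \<in> A})"
    using assms by (intro card_SigmaI) auto
  moreover have "card B * card F \<le> 2 * (\<Sum>b\<in>B. card {f\<in>F. f + b \<in> A})"
    using sum_mono[OF half, of B] by (simp add: sum_distrib_left)
  ultimately have "card B * card F \<le> 2 * (card F * card A)"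
    by (simp only: card_cartesian_product)
  then have "card F * card B \<le> card F * (2 * card A)"
    by (simp only: mult_ac)
  then have "card B \<le> 2 * card A"
    using assms by (simp add: card_gt_0_iff)
  then show thesis using that B' unfolding A_def by blast
qed

text \<open>Either some iterate K + \<dots> + K + M is already almost invariant, or the
  iterates grow so much that an almost invariant set at least half as large as a late iterate outweighs M.\<close>
lemma folner_sandwich:
  fixes K :: "'g::group_add set"
  assumes fol: "folner_condition TYPE('g)"
    and K: "finite K" "0 \<in> K" and eps: "(\<epsilon>::real) > 0"
  obtains L where "finite L" "0 \<in> L"
    "\<And>M. finite M \<Longrightarrow> M \<noteq> {} \<Longrightarrow>
       \<exists>T. M \<subseteq> T \<and> T \<subseteq> L + M \<and> real (card (K + T)) \<le> (1 + \<epsilon>) * real (card T)"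
proof -
  obtain F1 where F1: "finite F1" "F1 \<noteq> {}" "real (card (K + F1)) \<le> (1 + \<epsilon>/4) * real (card F1)"
    using fol K eps unfolding folner_condition_def by (metis divide_pos_pos zero_less_numeral)
  obtain f where f: "f \<in> F1" using F1 by blast
  \<comment> \<open>A right translate changes neither |F| nor |K + F|, but brings 0 into F, so that
    every iterate \<open>P j\<close> lies in F + \<open>P J\<close>.\<close>
  define F where "F = F1 + {- f}"
  have F: "finite F" "F \<noteq> {}" "0 \<in> F" "card F = card F1"
    using F1 f by (auto simp: F_def card_set_plus_singleton_right) (auto simp: set_plus_def)
  have "K + F = (K + F1) + {- f}"
    by (simp add: F_def add.assoc)
  then have KF: "real (card (K + F)) \<le> (1 + \<epsilon>/4) * real (card F)"
    using F1 F by (simp add: card_set_plus_singleton_right)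
  \<comment> \<open>After J steps of growth by the factor 1 + \<epsilon>, the iterate outweighs M by
    4|K|/\<epsilon>, which is what makes K + M negligible below.\<close>
  obtain J where J: "(1 + \<epsilon>) ^ J > 4 * real (card K) / \<epsilon>"
    using real_arch_pow[of "1 + \<epsilon>"] eps by auto
  define P where "P j = ((+) K ^^ j) {0}" for j
  have P0: "P 0 = {0}" and PS: "P (Suc j) = K + P j" for j
    by (simp_all add: P_def)
  have P: "finite (P j)" "0 \<in> P j" for j
    by (induction j) (use K subset_set_plus_left[OF K(2)] in \<open>auto simp: P0 PS finite_set_plus\<close>)
  have "P j \<subseteq> P (Suc j)" for j
    unfolding PS using K by (intro subset_set_plus_left)
  then have Pmono: "i \<le> j \<Longrightarrow> P i \<subseteq> P j" for i j
    by (rule lift_Suc_mono_le)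
  define L where "L = F + P J"
  show thesis
  proof (rule that[of L])
    show "finite L" unfolding L_def using F P by (intro finite_set_plus)
    show "0 \<in> L" unfolding L_def using F P set_plus_intro[of 0 F 0 "P J"] by simp
    fix M :: "'g set" assume M: "finite M" "M \<noteq> {}"
    have PL: "P j + M \<subseteq> L + M" if "j \<le> J" for j
    proof (rule set_plus_mono2)
      show "P j \<subseteq> L"
        unfolding L_def using Pmono[OF that] subset_set_plus_left[OF F(3)] by blast
    qed simp
    have MP: "M \<subseteq> P j + M" for j using P by (intro subset_set_plus_left)
    show "\<exists>T. M \<subseteq> T \<and> T \<subseteq> L + M \<and> real (card (K + T)) \<le> (1 + \<epsilon>) * real (card T)"
    proof (cases "\<exists>j\<le>J. real (card (K + (P j + M))) \<le> (1 + \<epsilon>) * real (card (P j + M))")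
      case True
      then show ?thesis using PL MP by blast
    next
      case False
      have grow: "j \<le> J \<Longrightarrow> (1 + \<epsilon>) ^ j * real (card M) \<le> real (card (P j + M))" for j
      proof (induction j)
        case 0 then show ?case using MP[of 0] M P[of 0] by (simp add: card_mono finite_set_plus)
      next
        case (Suc j)
        have "(1 + \<epsilon>) ^ Suc j * real (card M) \<le> (1 + \<epsilon>) * real (card (P j + M))"
          using Suc eps by (simp add: mult.assoc)
        also have "\<dots> \<le> real (card (K + (P j + M)))" using False Suc.prems Suc_leD nle_le by blast
        finally show ?case by (simp add: PS add.assoc)
      qed
      define B where "B = P J + M"
      have finB: "finite B" unfolding B_def using P M by (intro finite_set_plus)
      obtain B' where B': "B' \<subseteq> B" "card B' * card F \<le> 2 * card (F + B')" "card B \<le> 2 * card (F + B')"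
        using half_disjoint_translates[OF F(1,2) finB] by blast
      define A where "A = F + B'"
      have finB': "finite B'" using B' finB finite_subset by blast
      have finA: "finite A" unfolding A_def using F finB' by (intro finite_set_plus)
      \<comment> \<open>Elements leaving A leave some translate F + b' through its own boundary.
        Half-disjointness bounds |B'||F| by 2|A|, so the relative boundary \<epsilon>/4 of F becomes
        at most \<epsilon>/2 for A.\<close>
      have "K + A \<subseteq> A \<union> ((K + F - F) + B')"
        unfolding A_def add.assoc[symmetric] by (force simp: set_plus_def)
      then have "card (K + A) \<le> card (A \<union> ((K + F - F) + B'))"
        using finA finB' F K by (intro card_mono) (auto intro!: finite_set_plus)
      also have "\<dots> \<le> card A + card ((K + F - F) + B')" by (rule card_Un_le)
      also have "card ((K + F - F) + B') \<le> card (K + F - F) * card B'"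
        using finB' F K by (intro card_set_plus_le) (auto intro!: finite_set_plus)
      finally have "real (card (K + A)) \<le> real (card A) + real (card (K + F - F)) * real (card B')"
        by (metis add_left_mono of_nat_add of_nat_le_iff of_nat_mult)
      moreover have "real (card (K + F - F)) \<le> \<epsilon>/4 * real (card F)"
        using KF card_Diff_subset[OF F(1) subset_set_plus_left[OF K(2)]]
          card_mono[OF finite_set_plus[OF K(1) F(1)] subset_set_plus_left[OF K(2)]]
        by (simp add: of_nat_diff) (simp add: algebra_simps)
      then have "real (card (K + F - F)) * real (card B') \<le> \<epsilon>/4 * (real (card B') * real (card F))"
        using mult_right_mono[of _ _ "real (card B')"] by (fastforce simp: algebra_simps)
      moreover have "\<epsilon>/4 * (real (card B') * real (card F)) \<le> \<epsilon>/4 * (2 * real (card A))"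
        using B'(2) eps unfolding A_def by (intro mult_left_mono) (simp_all flip: of_nat_mult add: of_nat_le_iff)
      ultimately have KA: "real (card (K + A)) \<le> (1 + \<epsilon>/2) * real (card A)"
        by (simp add: algebra_simps)
      have "4 * real (card K) / \<epsilon> * real (card M) \<le> real (card B)"
        using grow[of J] mult_right_mono[OF less_imp_le[OF J], of "real (card M)"] unfolding B_def by simp
      also have "\<dots> \<le> 2 * real (card A)" using B'(3) unfolding A_def by linarith
      finally have KM: "real (card K) * real (card M) \<le> \<epsilon>/2 * real (card A)"
        using eps by (simp add: field_simps)
      \<comment> \<open>The error \<epsilon> is spent in two halves: one on the boundary of A, one
        on all of K + M.\<close>
      let ?T = "M \<union> A"
      have "K + ?T = (K + M) \<union> (K + A)" by (auto simp: set_plus_def)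
      then have "card (K + ?T) \<le> card (K + M) + card (K + A)" by (simp add: card_Un_le)
      also have "\<dots> \<le> card K * card M + card (K + A)"
        using card_set_plus_le[OF K(1) M(1)] by simp
      finally have "real (card (K + ?T)) \<le> real (card K) * real (card M) + real (card (K + A))"
        by (metis of_nat_add of_nat_le_iff of_nat_mult)
      then have "real (card (K + ?T)) \<le> (1 + \<epsilon>) * real (card A)"
        using KM KA by (simp add: algebra_simps)
      also have "\<dots> \<le> (1 + \<epsilon>) * real (card ?T)"
        using eps M finA by (intro mult_left_mono) (auto intro: card_mono)
      finally have "real (card (K + ?T)) \<le> (1 + \<epsilon>) * real (card ?T)" .
      moreover have "A \<subseteq> L + M"
        unfolding A_def L_def add.assoc using B' by (intro set_plus_mono2) (auto simp: B_def)
      moreover have "M \<subseteq> L + M" using MP PL by blast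
      ultimately show ?thesis by blast
    qed
  qed
qed

text \<open>An element of T outside the interior has the form -k + y with k in K and y in K + T - T,
  so each of the at most \<epsilon>|T| excess elements spoils at most |K| elements of T.\<close>

lemma card_interior_ge:
  fixes K T :: "'g::group_add set"
  assumes "finite K" "0 \<in> K" "finite T" "real (card (K + T)) \<le> (1 + \<epsilon>) * real (card T)"
  shows "real (card {s. \<forall>k\<in>K. k + s \<in> T}) \<ge> (1 - real (card K) * \<epsilon>) * real (card T)"
proof -
  let ?Z = "{s. \<forall>k\<in>K. k + s \<in> T}"
  let ?N = "K + T - T"
  have finN: "finite ?N" using assms by (intro finite_Diff finite_set_plus)
  have TK: "T \<subseteq> K + T" using assms by (intro subset_set_plus_left)
  have ZT: "?Z \<subseteq> T" using assms(2) by force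
  have "card (T - ?Z) \<le> card (K \<times> ?N)"
  proof (rule surj_card_le)
    show "finite (K \<times> ?N)" using finN assms by simp
    show "T - ?Z \<subseteq> (\<lambda>(k, y). - k + y) ` (K \<times> ?N)"
    proof
      fix s assume "s \<in> T - ?Z"
      then obtain k where "k \<in> K" "k + s \<notin> T" "s \<in> T" by blast
      then have "(k, k + s) \<in> K \<times> ?N" by (auto intro: set_plus_intro)
      then show "s \<in> (\<lambda>(k, y). - k + y) ` (K \<times> ?N)"
        by (rule rev_image_eqI) (simp add: add.assoc[symmetric])
    qed
  qed
  then have "real (card T) - real (card ?Z) \<le> real (card K) * real (card ?N)"
    using ZT assms(3) by (simp add: card_Diff_subset finite_subset card_cartesian_product flip: of_nat_mult)
  moreover have "real (card ?N) \<le> \<epsilon> * real (card T)"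
    using assms TK by (simp add: card_Diff_subset of_nat_diff card_mono finite_set_plus algebra_simps)
  then have "real (card K) * real (card ?N) \<le> real (card K) * (\<epsilon> * real (card T))"
    by (intro mult_left_mono) auto
  ultimately show ?thesis by (simp add: algebra_simps)
qed

section \<open>Subequivalence for actions and the transformation groupoid\<close>

text \<open>The groupoid relation with every bisection carried by a single group element. It implies
  the groupoid relation, and is equivalent to it when R is compact.\<close>

definition act_subeq :: "('g \<Rightarrow> 'x::topological_space \<Rightarrow> 'x) \<Rightarrow> 'x set \<Rightarrow> 'x set \<Rightarrow> bool" where
  "act_subeq \<alpha> R U \<longleftrightarrow> (\<exists>(n::nat) B g.
     (\<forall>j<n. open (B j)) \<and> R \<subseteq> (\<Union>j<n. B j) \<and> (\<forall>j<n. \<alpha> (g j) ` B j \<subseteq> U) \<and>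
     (\<forall>i<n. \<forall>j<n. i \<noteq> j \<longrightarrow> \<alpha> (g i) ` B i \<inter> \<alpha> (g j) ` B j = {}))"

text \<open>Any finite index type is allowed, so that witnesses may be indexed by disjoint sums,
  products, or pairs of a tower and a level.\<close>

lemma act_subeqI:
  assumes "finite J" and "\<And>j. j \<in> J \<Longrightarrow> open (B j)" and "R \<subseteq> (\<Union>j\<in>J. B j)"
    and "\<And>j. j \<in> J \<Longrightarrow> \<alpha> (g j) ` B j \<subseteq> U"
    and "\<And>i j. i \<in> J \<Longrightarrow> j \<in> J \<Longrightarrow> i \<noteq> j \<Longrightarrow> \<alpha> (g i) ` B i \<inter> \<alpha> (g j) ` B j = {}"
  shows "act_subeq \<alpha> R U"
proof -
  obtain h where h: "bij_betw h {..<card J} J"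
    using ex_bij_betw_nat_finite[OF assms(1)] by (auto simp: atLeast0LessThan)
  have hJ: "h k \<in> J" if "k < card J" for k using h that by (auto simp: bij_betw_def)
  have hinj: "h k \<noteq> h k'" if "k < card J" "k' < card J" "k \<noteq> k'" for k k'
    using h that by (auto simp: bij_betw_def inj_on_def)
  have cov: "R \<subseteq> (\<Union>k<card J. B (h k))"
  proof
    fix x assume "x \<in> R"
    then obtain j where "j \<in> J" "x \<in> B j" using assms(3) by blast
    moreover then obtain k where "k < card J" "j = h k" using h by (auto simp: bij_betw_def)
    ultimately show "x \<in> (\<Union>k<card J. B (h k))" by blast
  qed
  show ?thesis unfolding act_subeq_def
    by (intro exI[of _ "card J"] exI[of _ "\<lambda>k. B (h k)"] exI[of _ "\<lambda>k. g (h k)"] conjI allI impI cov)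
       (simp_all only: assms hJ hinj not_False_eq_True)
qed

lemma act_subeqE:
  assumes "act_subeq \<alpha> R U"
  obtains J :: "nat set" and B g where "finite J" "\<And>j. j \<in> J \<Longrightarrow> open (B j)" "R \<subseteq> (\<Union>j\<in>J. B j)"
    "\<And>j. j \<in> J \<Longrightarrow> \<alpha> (g j) ` B j \<subseteq> U"
    "\<And>i j. i \<in> J \<Longrightarrow> j \<in> J \<Longrightarrow> i \<noteq> j \<Longrightarrow> \<alpha> (g i) ` B i \<inter> \<alpha> (g j) ` B j = {}"
proof -
  obtain n B g where "\<forall>j<n::nat. open (B j)" "R \<subseteq> (\<Union>j<n. B j)" "\<forall>j<n. \<alpha> (g j) ` B j \<subseteq> U"
     "\<forall>i<n. \<forall>j<n. i \<noteq> j \<longrightarrow> \<alpha> (g i) ` B i \<inter> \<alpha> (g j) ` B j = {}"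
    using assms unfolding act_subeq_def by (elim exE conjE) (rule that; assumption)
  then show thesis by (intro that[of "{..<n}" B g]) (simp_all add: lessThan_iff)
qed

lemma act_subeq_mono:
  assumes "act_subeq \<alpha> R U" "R' \<subseteq> R" "U \<subseteq> U'"
  shows "act_subeq \<alpha> R' U'"
  using assms(1)
proof (rule act_subeqE)
  fix J :: "nat set" and B g
  assume "finite J" "\<And>j. j \<in> J \<Longrightarrow> open (B j)" "R \<subseteq> (\<Union>j\<in>J. B j)"
    "\<And>j. j \<in> J \<Longrightarrow> \<alpha> (g j) ` B j \<subseteq> U"
    "\<And>i j. i \<in> J \<Longrightarrow> j \<in> J \<Longrightarrow> i \<noteq> j \<Longrightarrow> \<alpha> (g i) ` B i \<inter> \<alpha> (g j) ` B j = {}"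
  then show ?thesis using assms(2,3) by (intro act_subeqI[of J B _ _ g]) (assumption | meson order_trans)+
qed

lemma act_subeq_Un:
  assumes "act_subeq \<alpha> R U" "act_subeq \<alpha> R' U'" "U \<inter> U' = {}"
  shows "act_subeq \<alpha> (R \<union> R') (U \<union> U')"
  using assms(1)
proof (rule act_subeqE)
  fix J :: "nat set" and B g
  assume 1: "finite J" "\<And>j. j \<in> J \<Longrightarrow> open (B j)" "R \<subseteq> (\<Union>j\<in>J. B j)"
    "\<And>j. j \<in> J \<Longrightarrow> \<alpha> (g j) ` B j \<subseteq> U"
    "\<And>i j. i \<in> J \<Longrightarrow> j \<in> J \<Longrightarrow> i \<noteq> j \<Longrightarrow> \<alpha> (g i) ` B i \<inter> \<alpha> (g j) ` B j = {}"
  from assms(2) show ?thesis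
  proof (rule act_subeqE)
    fix J' :: "nat set" and B' g'
    assume 2: "finite J'" "\<And>j. j \<in> J' \<Longrightarrow> open (B' j)" "R' \<subseteq> (\<Union>j\<in>J'. B' j)"
      "\<And>j. j \<in> J' \<Longrightarrow> \<alpha> (g' j) ` B' j \<subseteq> U'"
      "\<And>i j. i \<in> J' \<Longrightarrow> j \<in> J' \<Longrightarrow> i \<noteq> j \<Longrightarrow> \<alpha> (g' i) ` B' i \<inter> \<alpha> (g' j) ` B' j = {}"
    let ?B = "case_sum B B'" and ?g = "case_sum g g'"
    show ?thesis
    proof (rule act_subeqI[of "J <+> J'" ?B _ _ ?g])
      fix i j assume ij: "i \<in> J <+> J'" "j \<in> J <+> J'" "i \<noteq> j"
      have cross: "\<alpha> (g a) ` B a \<inter> \<alpha> (g' b) ` B' b = {}" if "a \<in> J" "b \<in> J'" for a b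
        using 1(4)[OF that(1)] 2(4)[OF that(2)] assms(3) by blast
      have cross': "\<alpha> (g' b) ` B' b \<inter> \<alpha> (g a) ` B a = {}" if "a \<in> J" "b \<in> J'" for a b
        using cross[OF that] by (simp only: Int_commute)
      show "\<alpha> (?g i) ` ?B i \<inter> \<alpha> (?g j) ` ?B j = {}"
        using ij by (elim PlusE) (simp_all add: 1(5) 2(5) cross cross')
    next
      show "finite (J <+> J')" using 1(1) 2(1) by simp
      show "open (?B j)" if "j \<in> J <+> J'" for j using that by (elim PlusE) (simp_all add: 1(2) 2(2))
      show "R \<union> R' \<subseteq> (\<Union>j\<in>J <+> J'. ?B j)"
        using 1(3) 2(3) by (simp add: Plus_def image_Un) blast
      show "\<alpha> (?g j) ` ?B j \<subseteq> U \<union> U'" if "j \<in> J <+> J'" for j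
        using that 1(4) 2(4) by (elim PlusE) (simp_all add: le_supI1 le_supI2)
    qed
  qed
qed

section \<open>Actions by homeomorphisms and their subequivalence calculus\<close>

locale top_action =
  fixes \<alpha> :: "'g::group_add \<Rightarrow> 'x::metric_space \<Rightarrow> 'x"
  assumes action: "group_action \<alpha>"
begin

lemma act_0 [simp]: "\<alpha> 0 x = x"
  using action by (simp add: group_action_def)

lemma act_add: "\<alpha> (g + h) x = \<alpha> g (\<alpha> h x)"
  using action by (simp add: group_action_def)

lemma act_minus [simp]: "\<alpha> (- g) (\<alpha> g x) = x" "\<alpha> g (\<alpha> (- g) x) = x"
  by (simp_all flip: act_add)

lemma act_diff [simp]: "\<alpha> (g - h) (\<alpha> h x) = \<alpha> g x"
  by (simp flip: act_add)

lemma act_eq_iff [simp]: "\<alpha> g x = \<alpha> g y \<longleftrightarrow> x = y"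
  using act_minus(1) by metis

lemma act_image: "\<alpha> g ` W = {x. \<alpha> (- g) x \<in> W}"
  by (auto simp: image_iff) (metis act_minus(2))

lemma cont_act: "continuous_on UNIV (\<alpha> g)"
  using action by (simp add: group_action_def)

lemma open_act: assumes "open W" shows "open (\<alpha> g ` W)"
  using open_vimage[OF assms cont_act[of "- g"]] unfolding act_image vimage_def .

lemma act_subeq_trans:
  assumes "act_subeq \<alpha> R Y" "act_subeq \<alpha> Y U"
  shows "act_subeq \<alpha> R U"
  using assms(1)
proof (rule act_subeqE)
  fix J :: "nat set" and B g
  assume 1: "finite J" "\<And>j. j \<in> J \<Longrightarrow> open (B j)" "R \<subseteq> (\<Union>j\<in>J. B j)"
    "\<And>j. j \<in> J \<Longrightarrow> \<alpha> (g j) ` B j \<subseteq> Y"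
    "\<And>i j. i \<in> J \<Longrightarrow> j \<in> J \<Longrightarrow> i \<noteq> j \<Longrightarrow> \<alpha> (g i) ` B i \<inter> \<alpha> (g j) ` B j = {}"
  from assms(2) show ?thesis
  proof (rule act_subeqE)
    fix J' :: "nat set" and B' g'
    assume 2: "finite J'" "\<And>j. j \<in> J' \<Longrightarrow> open (B' j)" "Y \<subseteq> (\<Union>j\<in>J'. B' j)"
      "\<And>j. j \<in> J' \<Longrightarrow> \<alpha> (g' j) ` B' j \<subseteq> U"
      "\<And>i j. i \<in> J' \<Longrightarrow> j \<in> J' \<Longrightarrow> i \<noteq> j \<Longrightarrow> \<alpha> (g' i) ` B' i \<inter> \<alpha> (g' j) ` B' j = {}"
    \<comment> \<open>The part of \<open>B j\<close> that \<open>g j\<close> sends into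
      \<open>B' k\<close> is moved by the composite. If two images meet, the second family forces k
      = k'; cancelling \<open>g' k\<close> then lets the first family force j = j'.\<close>
    let ?B = "\<lambda>(j, k). B j \<inter> \<alpha> (g j) -` B' k" and ?g = "\<lambda>(j, k). g' k + g j"
    show ?thesis
    proof (rule act_subeqI[of "J \<times> J'" ?B _ _ ?g])
      show "finite (J \<times> J')" using 1 2 by simp
      show "open (?B p)" if "p \<in> J \<times> J'" for p
        using that 1(2) 2(2) by (auto intro!: open_Int open_vimage cont_act)
      show "R \<subseteq> (\<Union>p\<in>J \<times> J'. ?B p)"
      proof
        fix x assume "x \<in> R"
        then obtain j where j: "j \<in> J" "x \<in> B j" using 1(3) by blast
        then have "\<alpha> (g j) x \<in> Y" using 1(4) by blast
        then obtain k where "k \<in> J'" "\<alpha> (g j) x \<in> B' k" using 2(3) by blast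
        then show "x \<in> (\<Union>p\<in>J \<times> J'. ?B p)" using j by force
      qed
      show "\<alpha> (?g p) ` ?B p \<subseteq> U" if "p \<in> J \<times> J'" for p
        using that 2(4) by (fastforce simp: act_add)
      fix p q assume pq: "p \<in> J \<times> J'" "q \<in> J \<times> J'" "p \<noteq> q"
      obtain j k j' k' where e: "p = (j, k)" "q = (j', k')" by fastforce
      show "\<alpha> (?g p) ` ?B p \<inter> \<alpha> (?g q) ` ?B q = {}"
      proof (rule ccontr)
        assume "\<not> ?thesis"
        then obtain x x' where x: "x \<in> B j" "\<alpha> (g j) x \<in> B' k" "x' \<in> B j'" "\<alpha> (g j') x' \<in> B' k'"
          and eq: "\<alpha> (g' k) (\<alpha> (g j) x) = \<alpha> (g' k') (\<alpha> (g j') x')"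
          unfolding e by (auto simp: act_add)
        have kk: "k = k'"
        proof (rule ccontr)
          assume "k \<noteq> k'"
          then have "\<alpha> (g' k) ` B' k \<inter> \<alpha> (g' k') ` B' k' = {}" using 2(5) pq e by blast
          then show False using x eq by blast
        qed
        then have "\<alpha> (g j) x = \<alpha> (g j') x'" using eq by simp
        moreover have "j \<noteq> j'" using pq e kk by blast
        then have "\<alpha> (g j) ` B j \<inter> \<alpha> (g j') ` B j' = {}" using 1(5) pq e by blast
        ultimately show False using x by blast
      qed
    qed
  qed
qed

text \<open>The element \<open>f i s - s\<close> carries level s of a tower onto level
  \<open>f i s\<close>, so any injection of indices within each tower is a subequivalence; the
  castle condition keeps the images disjoint.\<close>

lemma act_subeq_tower_levels:
  assumes tc: "tower_castle \<alpha> I T U" and op: "\<And>i. i \<in> I \<Longrightarrow> open (U i)"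
    and P: "\<And>i. i \<in> I \<Longrightarrow> P i \<subseteq> T i" and Q: "\<And>i. i \<in> I \<Longrightarrow> Q i \<subseteq> T i"
    and card: "\<And>i. i \<in> I \<Longrightarrow> card (P i) \<le> card (Q i)"
  shows "act_subeq \<alpha> (\<Union>i\<in>I. \<Union>s\<in>P i. \<alpha> s ` U i) (\<Union>i\<in>I. \<Union>s\<in>Q i. \<alpha> s ` U i)"
proof -
  have finI: "finite I" and finT: "\<And>i. i \<in> I \<Longrightarrow> finite (T i)" using tc by (auto simp: tower_castle_def)
  have "\<exists>f. inj_on f (P i) \<and> f ` P i \<subseteq> Q i" if "i \<in> I" for i
    using card_le_inj[of "P i" "Q i"] finT[OF that] P[OF that] Q[OF that] card[OF that]
    by (meson finite_subset)
  then obtain f where f: "\<And>i. i \<in> I \<Longrightarrow> inj_on (f i) (P i)" "\<And>i. i \<in> I \<Longrightarrow> f i ` P i \<subseteq> Q i"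
    by metis
  let ?B = "\<lambda>(i, s). \<alpha> s ` U i" and ?g = "\<lambda>(i, s). f i s - s"
  have img: "\<alpha> (f i s - s) ` \<alpha> s ` U i = \<alpha> (f i s) ` U i" for i s
    by (simp add: image_image)
  show ?thesis
  proof (rule act_subeqI[of "Sigma I P" ?B _ _ ?g])
    show "finite (Sigma I P)" using finI finT P by (intro finite_SigmaI) (auto intro: finite_subset)
    show "open (?B p)" if "p \<in> Sigma I P" for p
      using that op by (auto intro: open_act)
    show "\<alpha> (?g p) ` ?B p \<subseteq> (\<Union>i\<in>I. \<Union>s\<in>Q i. \<alpha> s ` U i)" if "p \<in> Sigma I P" for p
      using that f(2) by (force simp: img)
    fix p q assume pq: "p \<in> Sigma I P" "q \<in> Sigma I P" "p \<noteq> q"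
    obtain i s j t where e: "p = (i, s)" "q = (j, t)" by fastforce
    have 1: "f i s \<in> T i" "f j t \<in> T j" "i \<in> I" "j \<in> I"
      using pq e f(2) Q by auto
    have "i \<noteq> j \<or> f i s \<noteq> f j t"
      using pq e f(1) by (auto simp: inj_on_def)
    then have "\<alpha> (f i s) ` U i \<inter> \<alpha> (f j t) ` U j = {}"
      using 1 tc unfolding tower_castle_def by metis
    then show "\<alpha> (?g p) ` ?B p \<inter> \<alpha> (?g q) ` ?B q = {}"
      unfolding e by (simp add: img)
  qed auto
qed

section \<open>Arrows and topology of the transformation groupoid\<close>

abbreviation "G \<equiv> transformation_groupoid \<alpha>"

abbreviation arr :: "'g \<Rightarrow> 'x \<Rightarrow> 'x \<times> 'g \<times> 'x" where
  "arr g x \<equiv> (\<alpha> g x, g, x)"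

lemma groupoid_simps [simp]:
  "gcarrier G = {arr g x | g x. True}"
  "gsrc G (y, g, x) = (x, 0, x)"
  "grng G (y, g, x) = (y, 0, y)"
  "gmult G (z, g, y) (y', h, x) = (z, g + h, x)"
  by (simp_all add: transformation_groupoid_def)

lemma gunits_eq: "gunits G = unit_emb UNIV"
  unfolding gunits_def unit_emb_def by force

lemma topspace_gtop: "topspace (gtop G) = {arr g x | g x. True}"
  by (auto simp: transformation_groupoid_def)

lemma continuous_arr: "continuous_map euclidean (gtop G) (arr g)"
  unfolding transformation_groupoid_def
  by (auto simp: continuous_map_in_subtopology continuous_map_pairwise o_def cont_act)

text \<open>An arrow is determined by its group element and its source. As \<Gamma> is discrete, the
  groupoid is the topological disjoint union of copies of X, one for each group element.\<close>

lemma openin_gtop_iff: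
  "openin (gtop G) A \<longleftrightarrow> A \<subseteq> {arr g x | g x. True} \<and> (\<forall>g. open {x. arr g x \<in> A})"
proof (intro iffI conjI allI)
  assume A: "openin (gtop G) A"
  then show "A \<subseteq> {arr g x | g x. True}"
    using openin_subset[OF A] topspace_gtop by blast
  show "open {x. arr g x \<in> A}" for g
    using openin_continuous_map_preimage[OF continuous_arr A, of g] by simp
next
  assume "A \<subseteq> {arr g x | g x. True} \<and> (\<forall>g. open {x. arr g x \<in> A})"
  then have A: "A \<subseteq> {arr g x | g x. True}" and op: "\<forall>g. open {x. arr g x \<in> A}" by auto
  let ?W = "\<lambda>g. {x. arr g x \<in> A}"
  let ?O = "\<Union>g. UNIV \<times> {g} \<times> ?W g"
  have "openin (prod_topology euclidean (prod_topology (discrete_topology UNIV) euclidean)) ?O"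
    using op by (intro openin_Union) (auto simp: openin_prod_Times_iff)
  moreover have "A = ?O \<inter> {arr g x | g x. True}" using A by auto
  ultimately show "openin (gtop G) A"
    unfolding transformation_groupoid_def by (auto simp: openin_subtopology)
qed

lemma openin_gtop_unit_emb: "openin (gtop G) (unit_emb W) \<longleftrightarrow> open W"
proof
  assume "openin (gtop G) (unit_emb W)"
  then have "open {x. arr 0 x \<in> unit_emb W}" using openin_gtop_iff by blast
  moreover have "{x. arr 0 x \<in> unit_emb W} = W" by (auto simp: unit_emb_def)
  ultimately show "open W" by simp
next
  assume "open W"
  moreover have "{x. arr g x \<in> unit_emb W} = (if g = 0 then W else {})" for g
    by (auto simp: unit_emb_def)
  moreover have "unit_emb W \<subseteq> {arr g x | g x. True}"
    by (force simp: unit_emb_def)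
  ultimately show "openin (gtop G) (unit_emb W)"
    by (simp add: openin_gtop_iff)
qed

text \<open>The projection to the discrete group is continuous, so its image of a compact set is
  compact, hence finite.\<close>

lemma compactin_gtop_finite:
  assumes "compactin (gtop G) K"
  obtains L where "finite L" "0 \<in> L" "K \<subseteq> {arr g x | g x. g \<in> L}"
proof -
  have "continuous_map (gtop G) (discrete_topology UNIV) (fst \<circ> snd)"
    unfolding transformation_groupoid_def
    by (simp add: continuous_map_from_subtopology continuous_map_compose[OF continuous_map_snd continuous_map_fst])
  then have "compactin (discrete_topology UNIV) ((fst \<circ> snd) ` K)"
    using assms image_compactin by blast
  then have "finite ((fst \<circ> snd) ` K)" by (simp add: compactin_discrete_topology)
  moreover have "K \<subseteq> {arr g x | g x. True}"
    using compactin_subset_topspace[OF assms] topspace_gtop by simp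
  then have "K \<subseteq> {arr g x | g x. g \<in> insert 0 ((fst \<circ> snd) ` K)}" by force
  ultimately show thesis using that by blast
qed

lemma compactin_gtop_arrows:
  assumes "compact (UNIV :: 'x set)" "finite L"
  shows "compactin (gtop G) {arr g x | g x. g \<in> L}"
proof -
  have "{arr g x | g x. g \<in> L} = (\<Union>g\<in>L. arr g ` UNIV)" by blast
  moreover have "compactin (gtop G) (arr g ` UNIV)" for g
    using image_compactin[OF _ continuous_arr] assms(1) by simp
  ultimately show ?thesis using compactin_Union[of "(\<lambda>g. arr g ` UNIV) ` L" "gtop G"] assms(2) by auto
qed

text \<open>An open bisection splits into open slices, one for each group element, and compactness
  keeps finitely many. Images of slices of the same bisection are disjoint because its range map is
  injective.\<close>

lemma gsubeq_imp_act_subeq: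
  assumes "gsubeq G (unit_emb R) (unit_emb U)" "compact R"
  shows "act_subeq \<alpha> R U"
proof -
  obtain n A where ob: "\<forall>i<n::nat. open_bisection G (A i)" and cov: "unit_emb R \<subseteq> (\<Union>i<n. gsrc G ` A i)"
    and rng: "\<forall>i<n. grng G ` A i \<subseteq> unit_emb U"
    and dis: "\<forall>i<n. \<forall>j<n. i \<noteq> j \<longrightarrow> grng G ` A i \<inter> grng G ` A j = {}"
    using assms(1) unfolding gsubeq_def by (elim exE conjE) (rule that; assumption)
  let ?B = "\<lambda>(i, g). {x. arr g x \<in> A i}"
  have opB: "open (?B p)" if "p \<in> {..<n} \<times> UNIV" for p
    using ob that by (auto simp: open_bisection_def openin_gtop_iff)
  have "R \<subseteq> (\<Union>p\<in>{..<n} \<times> UNIV. ?B p)"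
  proof
    fix x assume "x \<in> R"
    then have "(x, 0, x) \<in> (\<Union>i<n. gsrc G ` A i)" using cov unfolding unit_emb_def by blast
    then obtain i y g where i: "i < n" "(y, g, x) \<in> A i" by force
    then have "y = \<alpha> g x" using ob by (force simp: open_bisection_def bisection_def)
    then show "x \<in> (\<Union>p\<in>{..<n} \<times> UNIV. ?B p)" using i by auto
  qed
  with assms(2) opB obtain J where J: "J \<subseteq> {..<n} \<times> UNIV" "finite J" "R \<subseteq> (\<Union>p\<in>J. ?B p)"
    by (rule compactE_image)
  show ?thesis
  proof (rule act_subeqI[of J ?B _ _ snd])
    show "open (?B p)" if "p \<in> J" for p using opB J that by blast
    show "\<alpha> (snd p) ` ?B p \<subseteq> U" if "p \<in> J" for p
      using that J(1) rng by (fastforce simp: unit_emb_def)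
    fix p q assume pq: "p \<in> J" "q \<in> J" "p \<noteq> q"
    obtain i g j h where e: "p = (i, g)" "q = (j, h)" by fastforce
    have ij: "i < n" "j < n" using pq e J by auto
    show "\<alpha> (snd p) ` ?B p \<inter> \<alpha> (snd q) ` ?B q = {}"
    proof (rule ccontr)
      assume "\<not> ?thesis"
      then obtain x y where xy: "arr g x \<in> A i" "arr h y \<in> A j" "\<alpha> g x = \<alpha> h y" unfolding e by auto
      then have eq: "grng G (arr g x) = grng G (arr h y)" by simp
      then have "i = j" using dis ij xy by blast
      then have "arr g x = arr h y"
        using ob ij xy eq unfolding open_bisection_def bisection_def by (meson inj_onD)
      then show False using pq e \<open>i = j\<close> by simp
    qed
  qed (use J in auto)
qed

lemma act_subeq_imp_gsubeq:
  assumes "act_subeq \<alpha> R U"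
  shows "gsubeq G (unit_emb R) (unit_emb U)"
proof -
  obtain n B g where 1: "\<forall>j<n::nat. open (B j)" "R \<subseteq> (\<Union>j<n. B j)" "\<forall>j<n. \<alpha> (g j) ` B j \<subseteq> U"
     "\<forall>i<n. \<forall>j<n. i \<noteq> j \<longrightarrow> \<alpha> (g i) ` B i \<inter> \<alpha> (g j) ` B j = {}"
    using assms unfolding act_subeq_def by (elim exE conjE) (rule that; assumption)
  let ?A = "\<lambda>j. arr (g j) ` B j"
  have "open_bisection G (?A j)" if "j < n" for j
  proof -
    have "{x. arr h x \<in> ?A j} = (if h = g j then B j else {})" for h by auto
    then have "openin (gtop G) (?A j)" using 1(1) that by (auto simp: openin_gtop_iff)
    then show ?thesis by (auto simp: open_bisection_def bisection_def inj_on_def)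
  qed
  moreover have "unit_emb R \<subseteq> (\<Union>j<n. gsrc G ` ?A j)"
    using 1(2) by (force simp: unit_emb_def image_image)
  moreover have "grng G ` ?A j = unit_emb (\<alpha> (g j) ` B j)" for j
    by (simp add: unit_emb_def image_image)
  moreover have "unit_emb (\<alpha> (g j) ` B j) \<subseteq> unit_emb U" if "j < n" for j
    using 1(3) that unfolding unit_emb_def by blast
  moreover have "unit_emb (\<alpha> (g i) ` B i) \<inter> unit_emb (\<alpha> (g j) ` B j) = {}"
    if "i < n" "j < n" "i \<noteq> j" for i j
    using 1(4) that unfolding unit_emb_def by blast
  ultimately show ?thesis
    unfolding gsubeq_def by (intro exI[of _ n] exI[of _ ?A] conjI allI impI) (simp_all only:)
qed

end

section \<open>From castles to towers\<close>

lemma tower_castle_subset: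
  assumes tc: "tower_castle \<alpha> I E V" and TE: "\<And>i. i \<in> I \<Longrightarrow> T i \<subseteq> E i"
  shows "tower_castle \<alpha> I T V"
  unfolding tower_castle_def
proof (intro conjI ballI impI)
  show "finite I" using tc unfolding tower_castle_def by blast
  fix i assume i: "i \<in> I"
  have "finite (E i)" using tc i unfolding tower_castle_def by blast
  then show "finite (T i)" by (rule finite_subset[OF TE[OF i]])
  show "\<alpha> s ` V i \<inter> \<alpha> t ` V i = {}" if "s \<in> T i" "t \<in> T i" "s \<noteq> t" for s t
    using tc i TE[OF i] that unfolding tower_castle_def by blast
  show "\<alpha> s ` V i \<inter> \<alpha> t ` V j = {}" if "j \<in> I" "i \<noteq> j" "s \<in> T i" "t \<in> T j" for j s t
    using tc i TE[OF i] TE[OF that(1)] that unfolding tower_castle_def by blast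
qed

context top_action
begin

section \<open>Arrows in bisections, multisections and castles\<close>

lemma bisection_arrow: "bisection G B \<Longrightarrow> (y, g, x) \<in> B \<Longrightarrow> y = \<alpha> g x"
  unfolding bisection_def by auto

lemma bisection_src_inj:
  assumes "bisection G B" "(y, g, x) \<in> B" "(y', g', x) \<in> B"
  shows "g = g'"
  using inj_onD[of "gsrc G" B "(y, g, x)" "(y', g', x)"] assms unfolding bisection_def by simp

lemma bisection_rng_inj:
  assumes "bisection G B" "(y, g, x) \<in> B" "(y, g', x') \<in> B"
  shows "g = g'" "x = x'"
  using inj_onD[of "grng G" B "(y, g, x)" "(y, g', x')"] assms unfolding bisection_def by simp_all

lemma gsetprodE:
  assumes "(z, g, x) \<in> gsetprod G A B"
  obtains h k y where "(z, h, y) \<in> A" "(y, k, x) \<in> B" "g = h + k"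
  using assms unfolding gsetprod_def by auto

lemma gsetprodI: "(z, h, y) \<in> A \<Longrightarrow> (y, k, x) \<in> B \<Longrightarrow> (z, h + k, x) \<in> gsetprod G A B"
  unfolding gsetprod_def by force

lemma multisection_rng_level:
  assumes "multisection G F D" "i \<in> F" "j \<in> F" "(y, g, x) \<in> D i j"
  shows "(y, 0, y) \<in> D i i"
proof -
  have "(y, g, x) \<in> gsetprod G (D i i) (D i j)" using assms unfolding multisection_def by metis
  then obtain h k z where 1: "(y, h, z) \<in> D i i" by (rule gsetprodE)
  moreover have "D i i \<subseteq> unit_emb UNIV" using assms unfolding multisection_def gunits_eq by blast
  ultimately show ?thesis unfolding unit_emb_def by auto
qed

lemma multisection_src_level:
  assumes "multisection G F D" "i \<in> F" "j \<in> F" "(y, g, x) \<in> D i j"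
  shows "(x, 0, x) \<in> D j j"
proof -
  have "(y, g, x) \<in> gsetprod G (D i j) (D j j)" using assms unfolding multisection_def by metis
  then obtain h k z where 1: "(z, k, x) \<in> D j j" by (rule gsetprodE)
  moreover have "D j j \<subseteq> unit_emb UNIV" using assms unfolding multisection_def gunits_eq by blast
  ultimately show ?thesis unfolding unit_emb_def by auto
qed

lemma multisection_arrow_from_level:
  assumes "multisection G F D" "i \<in> F" "j \<in> F" "(x, 0, x) \<in> D j j"
  obtains g where "arr g x \<in> D i j"
proof -
  have "(x, 0, x) \<in> gsetprod G (D j i) (D i j)" using assms unfolding multisection_def by metis
  then obtain h k y where "(y, k, x) \<in> D i j" by (rule gsetprodE)
  moreover have "bisection G (D i j)" using assms unfolding multisection_def by metis
  ultimately show thesis using that bisection_arrow by blast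
qed

text \<open>A unit common to two levels composes with itself, so the product of these levels is
  nonempty, which a castle forbids for different multisections.\<close>

lemma castle_levels_disjoint:
  assumes "castle G I F D" "l \<in> I" "l' \<in> I" "i \<in> F l" "i' \<in> F l'"
    "(x, 0, x) \<in> D l i i" "(x, 0, x) \<in> D l' i' i'"
  shows "l = l'" "i = i'"
proof -
  have "(x, 0 + 0, x) \<in> gsetprod G (D l i i) (D l' i' i')"
    using assms(6,7) by (rule gsetprodI)
  then show l: "l = l'" using assms unfolding castle_def by fastforce
  have "multisection G (F l) (D l)" using assms unfolding castle_def by blast
  then show "i = i'" using assms l unfolding multisection_def by blast
qed

text \<open>A multisection is cut into towers according to the finitely many group elements that its
  arrows carry out of a base level. There may be infinitely many pieces, but by compactness finitely many of
  them suffice to leave a remainder inside the open set where the subequivalence is defined.\<close>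
lemma almost_elementary_towers:
  assumes ae: "almost_elementary G" and cpt: "compact (UNIV :: 'x set)"
    and L: "finite L" "0 \<in> L" and eps: "\<epsilon> > 0" and U: "open U" "U \<noteq> {}"
  obtains I E V M where "tower_castle \<alpha> I E V"
    "\<And>i. i \<in> I \<Longrightarrow> open (V i) \<and> V i \<noteq> {} \<and> M i \<noteq> {} \<and> L + M i \<subseteq> E i"
    "\<And>i s x y. i \<in> I \<Longrightarrow> s \<in> E i \<Longrightarrow> x \<in> V i \<Longrightarrow> y \<in> V i \<Longrightarrow> dist (\<alpha> s x) (\<alpha> s y) < \<epsilon>"
    "act_subeq \<alpha> (UNIV - (\<Union>i\<in>I. \<Union>s\<in>M i. \<alpha> s ` V i)) U"
proof -
  define K where "K = {arr g x | g x. g \<in> L}"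
  \<comment> \<open>Balls of radius \<epsilon>/2, so that two points of one level are within
    \<epsilon> of each other.\<close>
  define \<V> where "\<V> = range (\<lambda>x. unit_emb (ball x (\<epsilon>/2)) :: ('x \<times> 'g \<times> 'x) set)"
  have K: "compactin (gtop G) K" unfolding K_def using cpt L(1) by (rule compactin_gtop_arrows)
  have unitsK: "gunits G \<subseteq> K"
    unfolding gunits_eq K_def unit_emb_def using L(2) by force
  have "unit_emb U \<noteq> {}" "unit_emb U \<subseteq> gunits G" "openin (gtop G) (unit_emb U)"
    using U openin_gtop_unit_emb by (auto simp: gunits_eq unit_emb_def)
  moreover have "\<forall>W\<in>\<V>. openin (gtop G) W \<and> W \<subseteq> gunits G"
    unfolding \<V>_def using openin_gtop_unit_emb by (auto simp: gunits_eq unit_emb_def)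
  moreover have "gunits G \<subseteq> \<Union>\<V>"
    using eps centre_in_ball[of _ "\<epsilon>/2"] unfolding \<V>_def gunits_eq unit_emb_def by auto
  ultimately obtain I F C E D where C: "open_castle G I F C" and D: "open_castle G I E D"
    and ext: "extendable G K I F C E D" and lev: "\<forall>l\<in>I. \<forall>i\<in>E l. \<exists>W\<in>\<V>. D l i i \<subseteq> W"
    and rem: "gsubeq G (gunits G - castle_levels I F C) (unit_emb U)"
    using ae[unfolded almost_elementary_def, rule_format, of K "unit_emb U" \<V>] K unitsK
    by (elim exE conjE impE meta_impE) (assumption | rule that conjI)+
  have cas: "castle G I E D" and finI: "finite I"
    and opD: "\<And>l i j. l \<in> I \<Longrightarrow> i \<in> E l \<Longrightarrow> j \<in> E l \<Longrightarrow> openin (gtop G) (D l i j)"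
    using D unfolding open_castle_def castle_def by blast+
  have ms: "multisection G (E l) (D l)" and finE: "finite (E l)" if "l \<in> I" for l
    using cas that unfolding castle_def multisection_def by blast+
  have bis: "bisection G (D l i j)" if "l \<in> I" "i \<in> E l" "j \<in> E l" for l i j
    using ms that unfolding multisection_def by blast
  have FE: "F l \<subseteq> E l" and CD: "\<And>i j. i \<in> F l \<Longrightarrow> j \<in> F l \<Longrightarrow> C l i j = D l i j" if "l \<in> I" for l
    using ext that unfolding extendable_def by blast+

  define Rc where "Rc = {x. \<forall>l\<in>I. \<forall>i\<in>F l. arr 0 x \<notin> D l i i}"
  have Rc_eq: "gunits G - castle_levels I F C = unit_emb Rc"
    unfolding gunits_eq castle_levels_def Rc_def unit_emb_def using CD by auto
  have "closed Rc"
  proof -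
    have "open (- Rc)"
    proof -
      have "- Rc = (\<Union>l\<in>I. \<Union>i\<in>F l. {x. arr 0 x \<in> D l i i})" unfolding Rc_def by auto
      moreover have "open {x. arr 0 x \<in> D l i i}" if "l \<in> I" "i \<in> F l" for l i
        using opD[of l i i] FE that openin_gtop_iff by blast
      ultimately show ?thesis by (simp only:) (intro open_UN ballI; blast)
    qed
    then show ?thesis by (simp add: closed_def)
  qed
  then have "compact Rc" using cpt compact_Int_closed[of UNIV Rc] by simp
  then have sub: "act_subeq \<alpha> Rc U" using rem gsubeq_imp_act_subeq unfolding Rc_eq by blast
  obtain J :: "nat set" and B g where J: "finite J" "\<And>j. j \<in> J \<Longrightarrow> open (B j)" "Rc \<subseteq> (\<Union>j\<in>J. B j)"
    "\<And>j. j \<in> J \<Longrightarrow> \<alpha> (g j) ` B j \<subseteq> U"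
    "\<And>i j. i \<in> J \<Longrightarrow> j \<in> J \<Longrightarrow> i \<noteq> j \<Longrightarrow> \<alpha> (g i) ` B i \<inter> \<alpha> (g j) ` B j = {}"
    using sub by (rule act_subeqE) (rule that; (assumption | simp only:))
  \<comment> \<open>Everything in N can be moved into U already, so the towers need only cover the
    compact complement of N; this is where finitely many pieces suffice.\<close>
  define N where "N = (\<Union>j\<in>J. B j)"
  have opN: "open N" unfolding N_def using J(2) by blast

  define b where "b l = (SOME i. i \<in> F l)" for l
  define I' where "I' = {l\<in>I. F l \<noteq> {}}"
  have bF: "b l \<in> F l" if "l \<in> I'" for l
    using that unfolding I'_def b_def by (simp add: some_in_eq)
  have I'I: "l \<in> I" if "l \<in> I'" for l using that unfolding I'_def by blast
  have bE: "b l \<in> E l" if "l \<in> I'" for l using bF[OF that] FE[OF I'I[OF that]] by blast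
  define W where "W p = {x. \<forall>i\<in>E (fst p). arr (snd p i) x \<in> D (fst p) i (b (fst p))}" for p
  define \<Lambda> where "\<Lambda> = (SIGMA l:I'. E l \<rightarrow>\<^sub>E (UNIV :: 'g set))"
  have \<Lambda>: "fst p \<in> I'" "fst p \<in> I" "snd p \<in> extensional (E (fst p))" if "p \<in> \<Lambda>" for p
    using that I'I unfolding \<Lambda>_def by (auto simp: PiE_def)
  have opW: "open (W p)" if "p \<in> \<Lambda>" for p
  proof -
    have "W p = (\<Inter>i\<in>E (fst p). {x. arr (snd p i) x \<in> D (fst p) i (b (fst p))})" unfolding W_def by auto
    moreover have "open {x. arr (snd p i) x \<in> D (fst p) i (b (fst p))}" if "i \<in> E (fst p)" for i
      using opD[of "fst p" i "b (fst p)"] \<Lambda>[OF \<open>p \<in> \<Lambda>\<close>] bE that openin_gtop_iff by blast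
    ultimately show ?thesis using finE[OF \<Lambda>(2)[OF that]] by (auto intro: open_INT)
  qed
  have Wmem: "arr (snd p i) x \<in> D (fst p) i (b (fst p))" if "x \<in> W p" "i \<in> E (fst p)" for p i x
    using that unfolding W_def by simp
  have Wbis: "bisection G (D (fst p) i (b (fst p)))" if "p \<in> \<Lambda>" "i \<in> E (fst p)" for p i
    using bis[OF \<Lambda>(2)[OF that(1)] that(2) bE[OF \<Lambda>(1)[OF that(1)]]] .
  have Wlevel: "(\<alpha> (snd p i) x, 0, \<alpha> (snd p i) x) \<in> D (fst p) i i"
    if "p \<in> \<Lambda>" "x \<in> W p" "i \<in> E (fst p)" for p i x
    using multisection_rng_level[OF ms[OF \<Lambda>(2)[OF that(1)]] that(3) bE[OF \<Lambda>(1)[OF that(1)]] Wmem[OF that(2,3)]] .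
  have Wbase: "(x, 0, x) \<in> D (fst p) (b (fst p)) (b (fst p))" if "p \<in> \<Lambda>" "x \<in> W p" for p x
    using multisection_src_level[OF ms[OF \<Lambda>(2)[OF that(1)]] _ bE[OF \<Lambda>(1)[OF that(1)]]
        Wmem[OF that(2)]] bE[OF \<Lambda>(1)[OF that(1)]] by blast
  have Wdisj: "p = q" if p: "p \<in> \<Lambda>" and q: "q \<in> \<Lambda>" and x: "x \<in> W p" "x \<in> W q" and e: "fst p = fst q" for p q x
  proof -
    have "snd p i = snd q i" if i: "i \<in> E (fst p)" for i
      using bisection_src_inj[OF Wbis[OF p i] Wmem[OF x(1) i] Wmem[OF x(2), of i, folded e]] i e by simp
    then have "snd p = snd q"
      using extensionalityI[OF \<Lambda>(3)[OF p], of "snd q"] \<Lambda>(3)[OF q] e by simp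
    then show ?thesis using e by (rule prod_eqI[rotated])
  qed
  \<comment> \<open>Meeting levels lie over the same castle level. There the range map of the
    bisection from the base is injective, so the base points coincide, and by \<open>Wdisj\<close>
    the pieces do.\<close>
  have levels_disj: "p = q \<and> i = j"
    if "p \<in> \<Lambda>" "q \<in> \<Lambda>" "x \<in> W p" "y \<in> W q" "i \<in> E (fst p)" "j \<in> E (fst q)"
      "\<alpha> (snd p i) x = \<alpha> (snd q j) y" for p q x y i j
  proof -
    have "(\<alpha> (snd p i) x, 0, \<alpha> (snd p i) x) \<in> D (fst q) j j"
      using Wlevel[OF that(2,4,6)] that(7) by simp
    then have e: "fst p = fst q" "i = j"
      using castle_levels_disjoint[OF cas \<Lambda>(2)[OF that(1)] \<Lambda>(2)[OF that(2)] that(5,6) Wlevel[OF that(1,3,5)]]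
      by simp_all
    have "(\<alpha> (snd p i) x, snd q i, y) \<in> D (fst p) i (b (fst p))"
      using Wmem[OF that(4,6)] e that(7) by simp
    then have "x = y"
      using bisection_rng_inj(2)[OF Wbis[OF that(1,5)] Wmem[OF that(3,5)]] by simp
    then show ?thesis using Wdisj[OF that(1,2)] e that(3,4) by simp
  qed
  have cover: "\<exists>p\<in>\<Lambda>. \<exists>i\<in>F (fst p). x \<in> \<alpha> (snd p i) ` W p" if "x \<notin> N" for x
  proof -
    have "x \<notin> Rc" using that J(3) unfolding N_def by blast
    then obtain l i where l: "l \<in> I" "i \<in> F l" "(x, 0, x) \<in> D l i i" unfolding Rc_def by auto
    then have lI': "l \<in> I'" unfolding I'_def by blast
    have iE: "i \<in> E l" using l FE by blast
    have "(x, 0, x) \<in> gsetprod G (D l i (b l)) (D l (b l) i)"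
      using ms[OF l(1)] iE bE[OF lI'] l(3) unfolding multisection_def by metis
    then obtain h k y where y: "(x, h, y) \<in> D l i (b l)" by (rule gsetprodE)
    have ybase: "(y, 0, y) \<in> D l (b l) (b l)"
      using multisection_src_level[OF ms[OF l(1)] iE bE[OF lI'] y] .
    have "\<exists>g. arr g y \<in> D l k (b l)" if "k \<in> E l" for k
      using multisection_arrow_from_level[OF ms[OF l(1)] that bE[OF lI'] ybase] by blast
    then obtain w where w: "\<And>k. k \<in> E l \<Longrightarrow> arr (w k) y \<in> D l k (b l)" by metis
    let ?p = "(l, restrict w (E l))"
    have "?p \<in> \<Lambda>" unfolding \<Lambda>_def using lI' by auto
    moreover have "y \<in> W ?p" unfolding W_def using w by auto
    moreover have "w i = h"
      using bisection_src_inj[OF bis[OF l(1) iE bE[OF lI']] w[OF iE] y] .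
    then have "x = \<alpha> (w i) y" using bisection_arrow[OF bis[OF l(1) iE bE[OF lI']] y] by simp
    ultimately show ?thesis using l(2) iE by (intro bexI[of _ ?p] bexI[of _ i]) auto
  qed
  define \<Omega> where "\<Omega> = (SIGMA p:\<Lambda>. F (fst p))"
  have "compact (- N)" using cpt compact_Int_closed[of UNIV "- N"] opN by (simp add: closed_Compl)
  moreover have "open (\<alpha> (snd (fst q) (snd q)) ` W (fst q))" if "q \<in> \<Omega>" for q
    using that opW unfolding \<Omega>_def by (auto intro: open_act)
  moreover have "- N \<subseteq> (\<Union>q\<in>\<Omega>. \<alpha> (snd (fst q) (snd q)) ` W (fst q))"
    using cover unfolding \<Omega>_def by fastforce
  ultimately obtain \<Omega>0 where O0: "\<Omega>0 \<subseteq> \<Omega>" "finite \<Omega>0"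
      "- N \<subseteq> (\<Union>q\<in>\<Omega>0. \<alpha> (snd (fst q) (snd q)) ` W (fst q))"
    by (rule compactE_image)
  \<comment> \<open>Empty pieces are dropped: a base point is needed to transfer extendability from
    arrows to shapes.\<close>
  define P where "P = {p\<in>fst ` \<Omega>0. W p \<noteq> {}}"
  have finP: "finite P" unfolding P_def using O0 by simp
  have P\<Lambda>: "p \<in> \<Lambda>" if "p \<in> P" for p using that O0 unfolding P_def \<Omega>_def by auto
  obtain h where h: "bij_betw h {..<card P} P"
    using ex_bij_betw_nat_finite[OF finP] by (auto simp: atLeast0LessThan)
  have hP: "h k \<in> P" if "k < card P" for k using h that by (auto simp: bij_betw_def)
  have hinj: "k = k'" if "k < card P" "k' < card P" "h k = h k'" for k k'
    using h that by (auto simp: bij_betw_def inj_on_def)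
  show thesis
  proof (rule that[of "{..<card P}" "\<lambda>k. snd (h k) ` E (fst (h k))" "\<lambda>k. W (h k)"
        "\<lambda>k. snd (h k) ` F (fst (h k))"])
    show "tower_castle \<alpha> {..<card P} (\<lambda>k. snd (h k) ` E (fst (h k))) (\<lambda>k. W (h k))"
      unfolding tower_castle_def
    proof (intro conjI ballI impI)
      fix k assume k: "k \<in> {..<card P}"
      have p: "h k \<in> \<Lambda>" using P\<Lambda> hP k by blast
      show "finite (snd (h k) ` E (fst (h k)))" using finE \<Lambda>[OF p] by blast
      show "\<alpha> s ` W (h k) \<inter> \<alpha> t ` W (h k) = {}"
        if "s \<in> snd (h k) ` E (fst (h k))" "t \<in> snd (h k) ` E (fst (h k))" "s \<noteq> t" for s t
        using that levels_disj[OF p p] by blast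
      fix k' s t assume k': "k' \<in> {..<card P}" "k \<noteq> k'"
        and st: "s \<in> snd (h k) ` E (fst (h k))" "t \<in> snd (h k') ` E (fst (h k'))"
      have p': "h k' \<in> \<Lambda>" using P\<Lambda> hP k' by blast
      have "h k \<noteq> h k'" using hinj k k' by blast
      then show "\<alpha> s ` W (h k) \<inter> \<alpha> t ` W (h k') = {}"
        using st levels_disj[OF p p'] by blast
    qed simp
  next
    fix k assume k: "k \<in> {..<card P}"
    define p where "p = h k"
    have pP: "p \<in> P" using hP k unfolding p_def by blast
    have p: "p \<in> \<Lambda>" using P\<Lambda> pP by blast
    have F: "F (fst p) \<noteq> {}" using \<Lambda>(1)[OF p] unfolding I'_def by blast
    obtain x where x: "x \<in> W p" using pP unfolding P_def by blast
    \<comment> \<open>Follow a base point x: an arrow of K after the arrow from x to level i lies in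
      the outer castle. Its source x identifies the tower and the base column, so its group element
      is one of the outer shape.\<close>
    have "L + snd p ` F (fst p) \<subseteq> snd p ` E (fst p)"
    proof
      fix s assume "s \<in> L + snd p ` F (fst p)"
      then obtain g i where s: "g \<in> L" "i \<in> F (fst p)" "s = g + snd p i"
        by (auto simp: set_plus_def)
      let ?l = "fst p" and ?y = "\<alpha> (snd p i) x"
      have l: "?l \<in> I" "b ?l \<in> F ?l" "b ?l \<in> E ?l" "i \<in> E ?l"
        using \<Lambda>[OF p] bF bE FE s by blast+
      have "arr (snd p i) x \<in> D ?l i (b ?l)" using x l(4) unfolding W_def by blast
      then have "arr (snd p i) x \<in> castle_union I F C"
        using CD[OF l(1) s(2) l(2)] l s unfolding castle_union_def by blast
      moreover have "arr g ?y \<in> K" using s unfolding K_def by blast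
      ultimately have "(\<alpha> g ?y, g + snd p i, x) \<in> gsetprod G K (castle_union I F C)"
        by (intro gsetprodI)
      then have "(\<alpha> g ?y, s, x) \<in> castle_union I E D"
        using ext s unfolding extendable_def by blast
      then obtain l' i' j' where l': "l' \<in> I" "i' \<in> E l'" "j' \<in> E l'" "(\<alpha> g ?y, s, x) \<in> D l' i' j'"
        unfolding castle_union_def by blast
      have "(x, 0, x) \<in> D l' j' j'" using multisection_src_level[OF ms[OF l'(1)] l'(2,3,4)] .
      moreover have "(x, 0, x) \<in> D ?l (b ?l) (b ?l)" using Wbase[OF p x] .
      ultimately have e: "l' = ?l" "j' = b ?l"
        using castle_levels_disjoint[OF cas l'(1) l(1) l'(3) l(3)] by blast+
      have "arr (snd p i') x \<in> D ?l i' (b ?l)" using x l'(2) e unfolding W_def by blast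
      then have "s = snd p i'"
        using bisection_src_inj[OF bis[OF l'(1,2,3)] l'(4)] e by blast
      then show "s \<in> snd p ` E (fst p)" using l'(2) e by blast
    qed
    then show "open (W (h k)) \<and> W (h k) \<noteq> {} \<and> snd (h k) ` F (fst (h k)) \<noteq> {} \<and>
         L + snd (h k) ` F (fst (h k)) \<subseteq> snd (h k) ` E (fst (h k))"
      using opW[OF p] x F unfolding p_def by blast
    fix s x y assume s: "s \<in> snd (h k) ` E (fst (h k))" and xy: "x \<in> W (h k)" "y \<in> W (h k)"
    then obtain i where i: "i \<in> E (fst p)" "s = snd p i" unfolding p_def by blast
    obtain V where V: "V \<in> \<V>" "D (fst p) i i \<subseteq> V" using lev \<Lambda>[OF p] i by blast
    then obtain z where "D (fst p) i i \<subseteq> unit_emb (ball z (\<epsilon>/2))" unfolding \<V>_def by blast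
    then have "\<alpha> s x \<in> ball z (\<epsilon>/2)" "\<alpha> s y \<in> ball z (\<epsilon>/2)"
      using Wlevel[OF p] xy i unfolding p_def unit_emb_def by fastforce+
    then have "dist z (\<alpha> s x) < \<epsilon>/2" "dist z (\<alpha> s y) < \<epsilon>/2" by simp_all
    then show "dist (\<alpha> s x) (\<alpha> s y) < \<epsilon>" by (rule dist_triangle_half_r)
  next
    have "- N \<subseteq> (\<Union>k\<in>{..<card P}. \<Union>s\<in>snd (h k) ` F (fst (h k)). \<alpha> s ` W (h k))"
    proof
      fix x assume "x \<in> - N"
      then obtain q where q: "q \<in> \<Omega>0" "x \<in> \<alpha> (snd (fst q) (snd q)) ` W (fst q)" using O0(3) by blast
      then have "fst q \<in> P" unfolding P_def by blast
      then obtain k where "k < card P" "fst q = h k" using h by (auto simp: bij_betw_def)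
      moreover have "snd q \<in> F (fst (fst q))" using q(1) O0(1) unfolding \<Omega>_def by auto
      ultimately show "x \<in> (\<Union>k\<in>{..<card P}. \<Union>s\<in>snd (h k) ` F (fst (h k)). \<alpha> s ` W (h k))"
        using q(2) by auto
    qed
    then have "UNIV - (\<Union>k\<in>{..<card P}. \<Union>s\<in>snd (h k) ` F (fst (h k)). \<alpha> s ` W (h k)) \<subseteq> N" by blast
    then show "act_subeq \<alpha> (UNIV - (\<Union>k\<in>{..<card P}. \<Union>s\<in>snd (h k) ` F (fst (h k)). \<alpha> s ` W (h k))) U"
      using J unfolding N_def by (intro act_subeqI[of J B _ _ g])
  qed
qed

text \<open>The set L from the sandwich is what the castle is asked to extend by. The outer shape
  then contains L + M, hence the almost invariant T, and passing from M to T only shrinks the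
  remainder.\<close>

lemma almost_elementary_folner_towers:
  fixes K :: "'g set"
  assumes ae: "almost_elementary G" and cpt: "compact (UNIV :: 'x set)" and fol: "folner_condition TYPE('g)"
    and K: "finite K" "0 \<in> K" and eps: "\<epsilon> > 0" and eta: "\<eta> > 0" and U: "open U" "U \<noteq> {}"
  obtains I T V where "tower_castle \<alpha> I T V"
    "\<And>i. i \<in> I \<Longrightarrow> open (V i) \<and> V i \<noteq> {} \<and> T i \<noteq> {} \<and> real (card (K + T i)) \<le> (1 + \<epsilon>) * real (card (T i))"
    "\<And>i s x y. i \<in> I \<Longrightarrow> s \<in> T i \<Longrightarrow> x \<in> V i \<Longrightarrow> y \<in> V i \<Longrightarrow> dist (\<alpha> s x) (\<alpha> s y) < \<eta>"
    "act_subeq \<alpha> (UNIV - (\<Union>i\<in>I. \<Union>s\<in>T i. \<alpha> s ` V i)) U"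
proof -
  obtain L where L: "finite L" "0 \<in> L"
    "\<And>M. finite M \<Longrightarrow> M \<noteq> {} \<Longrightarrow>
       \<exists>T. M \<subseteq> T \<and> T \<subseteq> L + M \<and> real (card (K + T)) \<le> (1 + \<epsilon>) * real (card T)"
    using folner_sandwich[OF fol K eps] by blast
  obtain I E V M where tc: "tower_castle \<alpha> I E V"
    and M: "\<And>i. i \<in> I \<Longrightarrow> open (V i) \<and> V i \<noteq> {} \<and> M i \<noteq> {} \<and> L + M i \<subseteq> E i"
    and dist: "\<And>i s x y. i \<in> I \<Longrightarrow> s \<in> E i \<Longrightarrow> x \<in> V i \<Longrightarrow> y \<in> V i \<Longrightarrow> dist (\<alpha> s x) (\<alpha> s y) < \<eta>"
    and sub: "act_subeq \<alpha> (UNIV - (\<Union>i\<in>I. \<Union>s\<in>M i. \<alpha> s ` V i)) U"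
    by (rule almost_elementary_towers[OF ae cpt L(1,2) eta U]) (rule that; (assumption | simp only:))
  have finE: "finite (E i)" if "i \<in> I" for i using tc that unfolding tower_castle_def by blast
  have ME: "M i \<subseteq> E i" if "i \<in> I" for i
    using M[OF that] subset_set_plus_left[OF L(2), of "M i"] by blast
  have "\<exists>T. M i \<subseteq> T \<and> T \<subseteq> L + M i \<and> real (card (K + T)) \<le> (1 + \<epsilon>) * real (card T)" if "i \<in> I" for i
    using L(3)[of "M i"] M[OF that] finite_subset[OF ME finE] that by blast
  then obtain T where T: "\<And>i. i \<in> I \<Longrightarrow> M i \<subseteq> T i \<and> T i \<subseteq> L + M i \<and>
      real (card (K + T i)) \<le> (1 + \<epsilon>) * real (card (T i))"
    by metis
  have TE: "T i \<subseteq> E i" if "i \<in> I" for i using T[OF that] M[OF that] by blast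
  show thesis
  proof (rule that[of I T V])
    show "tower_castle \<alpha> I T V" using tc TE by (rule tower_castle_subset)
    show "open (V i) \<and> V i \<noteq> {} \<and> T i \<noteq> {} \<and> real (card (K + T i)) \<le> (1 + \<epsilon>) * real (card (T i))"
      if "i \<in> I" for i using M[OF that] T[OF that] by blast
    show "dist (\<alpha> s x) (\<alpha> s y) < \<eta>" if "i \<in> I" "s \<in> T i" "x \<in> V i" "y \<in> V i" for i s x y
      using dist TE that by blast
    have "UNIV - (\<Union>i\<in>I. \<Union>s\<in>T i. \<alpha> s ` V i) \<subseteq> UNIV - (\<Union>i\<in>I. \<Union>s\<in>M i. \<alpha> s ` V i)"
      using T by blast
    then show "act_subeq \<alpha> (UNIV - (\<Union>i\<in>I. \<Union>s\<in>T i. \<alpha> s ` V i)) U"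
      using act_subeq_mono[OF sub] by blast
  qed
qed

end

section \<open>Counting along orbits\<close>

text \<open>A supremum loses strictness, hence d/2 in the hypothesis.\<close>

lemma diameter_less_of_dist_less:
  fixes A :: "'x::metric_space set"
  assumes "\<And>x y. x \<in> A \<Longrightarrow> y \<in> A \<Longrightarrow> dist x y < d / 2" "0 < d"
  shows "diameter A < d"
proof (cases "A = {}")
  case False
  have "(SUP (x, y)\<in>A \<times> A. dist x y) \<le> d / 2"
    using False assms by (intro cSUP_least) (auto intro: less_imp_le)
  then show ?thesis using False assms(2) by (simp add: diameter_def)
qed (use assms(2) in simp)

context top_action
begin

text \<open>Left multiplication keeps sources, so products never cross between source fibres. The
  fibre of F over x is a copy of the finite set \<open>Fx x\<close>, and the new elements
  \<open>N x\<close> of all fibres embed disjointly into the boundary.\<close>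

lemma fiberwise_amenable_imp_folner:
  assumes cpt: "compact (UNIV :: 'x set)" and fa: "fiberwise_amenable G"
  shows "folner_condition TYPE('g)"
  unfolding folner_condition_def
proof (intro allI impI)
  fix K :: "'g set" and \<epsilon> :: real
  assume "finite K \<and> 0 < \<epsilon>"
  then have K: "finite K" and eps: "\<epsilon> > 0" by auto
  define K0 where "K0 = insert 0 K"
  have K0: "finite K0" "0 \<in> K0" "K \<subseteq> K0" using K by (auto simp: K0_def)
  define KK where "KK = {arr g x | g x. g \<in> K0}"
  have "KK \<subseteq> gcarrier G" "compactin (gtop G) KK"
    using compactin_gtop_arrows[OF cpt K0(1)] by (auto simp: KK_def)
  then obtain F where F: "F \<subseteq> gcarrier G" "finite F" "F \<noteq> {}"
    "real (card (gboundary G KK F)) \<le> \<epsilon> * real (card F)"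
    using fa eps unfolding fiberwise_amenable_def by metis
  have F1: "F \<subseteq> {arr g x | g x. True}" using F(1) by simp
  define Fx where "Fx x = {g. arr g x \<in> F}" for x
  define X where "X = (\<lambda>p. snd (snd p)) ` F"
  define N where "N x = K0 + Fx x - Fx x" for x
  let ?\<phi> = "\<lambda>(x, g). arr g x"
  have inj: "inj_on ?\<phi> A" for A by (auto simp: inj_on_def)
  have finX: "finite X" using F by (simp add: X_def)
  have finFx: "finite (Fx x)" for x
  proof (rule finite_subset)
    show "Fx x \<subseteq> (\<lambda>p. fst (snd p)) ` F" unfolding Fx_def by force
  qed (use F in simp)
  have finN: "finite (N x)" for x using K0 finFx by (simp add: N_def finite_set_plus)
  have "F = ?\<phi> ` Sigma X Fx"
  proof (intro set_eqI iffI)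
    fix p assume p: "p \<in> F"
    then obtain g x where e: "p = arr g x" using F1 by blast
    then have "x \<in> X" using p unfolding X_def by (metis imageI snd_conv)
    moreover have "g \<in> Fx x" using p e by (simp add: Fx_def)
    ultimately show "p \<in> ?\<phi> ` Sigma X Fx" using e by (intro image_eqI[of _ _ "(x, g)"]) auto
  qed (auto simp: Fx_def)
  then have cardF: "card F = (\<Sum>x\<in>X. card (Fx x))"
    using card_image[OF inj, of "Sigma X Fx"] card_SigmaI[OF finX, of Fx] finFx by simp
  have prod: "gsetprod G KK F \<subseteq> (\<lambda>(k, y, g, x). (\<alpha> k y, k + g, x)) ` (K0 \<times> F)"
  proof
    fix p assume "p \<in> gsetprod G KK F"
    then obtain z s x where e: "p = (z, s, x)" "(z, s, x) \<in> gsetprod G KK F" by (cases p) auto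
    from e(2) obtain k g y where "(z, k, y) \<in> KK" "(y, g, x) \<in> F" "s = k + g" by (rule gsetprodE)
    then show "p \<in> (\<lambda>(k, y, g, x). (\<alpha> k y, k + g, x)) ` (K0 \<times> F)"
      unfolding KK_def e(1) by (intro image_eqI[of _ _ "(k, y, g, x)"]) auto
  qed
  have finB: "finite (gboundary G KK F)"
    unfolding gboundary_def using F(2) K0 finite_subset[OF prod] by simp
  have "?\<phi> ` Sigma X N \<subseteq> gboundary G KK F"
  proof
    fix p assume "p \<in> ?\<phi> ` Sigma X N"
    then obtain x s where p: "p = arr s x" "x \<in> X" "s \<in> N x" by auto
    then obtain k g where s: "k \<in> K0" "g \<in> Fx x" "s = k + g" by (auto simp: N_def set_plus_def)
    have "(\<alpha> k (\<alpha> g x), k + g, x) \<in> gsetprod G KK F"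
      using s by (intro gsetprodI[of _ _ "\<alpha> g x"]) (auto simp: KK_def Fx_def)
    then have "p \<in> gsetprod G KK F" using p s by (simp add: act_add)
    moreover have "p \<notin> F" using p by (auto simp: N_def Fx_def)
    ultimately show "p \<in> gboundary G KK F" unfolding gboundary_def by blast
  qed
  then have "card (?\<phi> ` Sigma X N) \<le> card (gboundary G KK F)" using finB by (rule card_mono[rotated])
  then have "(\<Sum>x\<in>X. card (N x)) \<le> card (gboundary G KK F)"
    using card_image[OF inj, of "Sigma X N"] card_SigmaI[OF finX, of N] finN by simp
  then have tot: "(\<Sum>x\<in>X. real (card (N x))) \<le> (\<Sum>x\<in>X. \<epsilon> * real (card (Fx x)))"
    using F(4) cardF by (simp flip: sum_distrib_left of_nat_sum)
  have "X \<noteq> {}" using F(3) by (simp add: X_def)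
  then have "\<exists>x\<in>X. real (card (N x)) \<le> \<epsilon> * real (card (Fx x))"
    using tot finX sum_strict_mono[of X "\<lambda>x. \<epsilon> * real (card (Fx x))" "\<lambda>x. real (card (N x))"]
    by (meson not_less)
  then obtain x where x: "x \<in> X" "real (card (N x)) \<le> \<epsilon> * real (card (Fx x))" by blast
  have "Fx x \<noteq> {}" using x(1) F1 unfolding X_def Fx_def by fastforce
  moreover have "card (K + Fx x) \<le> card (Fx x \<union> N x)"
    using K0(3) finFx finN by (intro card_mono) (auto simp: N_def set_plus_def)
  then have "card (K + Fx x) \<le> card (Fx x) + card (N x)"
    using card_Un_le[of "Fx x" "N x"] by linarith
  then have "real (card (K + Fx x)) \<le> (1 + \<epsilon>) * real (card (Fx x))"
    using x(2) by (simp add: algebra_simps)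
  ultimately show "\<exists>F. finite F \<and> F \<noteq> {} \<and> real (card (K + F)) \<le> (1 + \<epsilon>) * real (card F)"
    using finFx by blast
qed

text \<open>A visit t to \<open>B j\<close> puts the point of index \<open>g j + t\<close> on the
  orbit of u into U, and each h in H moves it to a translate of U. These translates are disjoint, so
  the sums \<open>h + g (j t) + t\<close> are distinct. For T almost invariant, visits thus have
  density about 1/|H| at most.\<close>

lemma card_hitting_times_le:
  assumes fin: "finite H" "finite J" "finite T"
    and H: "\<And>h h'. h \<in> H \<Longrightarrow> h' \<in> H \<Longrightarrow> h \<noteq> h' \<Longrightarrow> \<alpha> h ` U \<inter> \<alpha> h' ` U = {}"
    and BU: "\<And>j. j \<in> J \<Longrightarrow> \<alpha> (g j) ` B j \<subseteq> U"
    and dis: "\<And>i j. i \<in> J \<Longrightarrow> j \<in> J \<Longrightarrow> i \<noteq> j \<Longrightarrow> \<alpha> (g i) ` B i \<inter> \<alpha> (g j) ` B j = {}"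
  shows "card H * card {t\<in>T. \<alpha> t u \<in> (\<Union>j\<in>J. B j)} \<le> card (H + g ` J + T)"
proof -
  let ?P = "{t\<in>T. \<alpha> t u \<in> (\<Union>j\<in>J. B j)}"
  have "\<exists>j\<in>J. \<alpha> t u \<in> B j" if "t \<in> ?P" for t using that by blast
  then obtain j where j: "\<And>t. t \<in> ?P \<Longrightarrow> j t \<in> J \<and> \<alpha> t u \<in> B (j t)" by metis
  have "card (H \<times> ?P) \<le> card (H + g ` J + T)"
  proof (rule card_inj_on_le[of "\<lambda>(h, t). h + g (j t) + t"])
    show "finite (H + g ` J + T)" using fin by (intro finite_set_plus) auto
    show "(\<lambda>(h, t). h + g (j t) + t) ` (H \<times> ?P) \<subseteq> H + g ` J + T"
      using j by (auto intro!: set_plus_intro)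
    show "inj_on (\<lambda>(h, t). h + g (j t) + t) (H \<times> ?P)"
    proof (rule inj_onI)
      fix p q assume pq: "p \<in> H \<times> ?P" "q \<in> H \<times> ?P"
        and eq': "(\<lambda>(h, t). h + g (j t) + t) p = (\<lambda>(h, t). h + g (j t) + t) q"
      obtain h t h' t' where e: "p = (h, t)" "q = (h', t')" by fastforce
      have h: "h \<in> H" "h' \<in> H" and P: "t \<in> ?P" "t' \<in> ?P" and eq: "h + g (j t) + t = h' + g (j t') + t'"
        using pq eq' unfolding e by auto
      let ?y = "\<alpha> (g (j t)) (\<alpha> t u)" and ?y' = "\<alpha> (g (j t')) (\<alpha> t' u)"
      have act: "\<alpha> h ?y = \<alpha> h' ?y'" using arg_cong[OF eq, of "\<lambda>s. \<alpha> s u"] by (simp add: act_add)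
      have yU: "?y \<in> U" "?y' \<in> U" using BU j[OF P(1)] j[OF P(2)] by blast+
      have hh: "h = h'"
      proof (rule ccontr)
        assume "h \<noteq> h'"
        then have "\<alpha> h ` U \<inter> \<alpha> h' ` U = {}" using H h by blast
        then show False using yU act by blast
      qed
      then have "?y = ?y'" using act by simp
      then have "j t = j t'" using dis j[OF P(1)] j[OF P(2)] by blast
      then show "p = q" using eq hh e by simp
    qed
  qed
  then show ?thesis by (simp add: card_cartesian_product)
qed

lemma free_action_eq_iff:
  assumes "free_action \<alpha>"
  shows "\<alpha> g x = \<alpha> h x \<longleftrightarrow> g = h"
proof
  assume "\<alpha> g x = \<alpha> h x"
  then have "\<alpha> (- h + g) x = x" by (simp add: act_add)
  then have "- h + g = 0" using assms unfolding free_action_def by blast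
  then have "h + (- h + g) = h" by simp
  then show "g = h" by (simp add: add.assoc[symmetric])
qed simp

text \<open>By freeness the points h x for h in H are distinct; pairwise separating neighbourhoods
  are pulled back to x and intersected over the finitely many pairs.\<close>

lemma free_action_separating_open:
  assumes free: "free_action \<alpha>" and fin: "finite H"
  obtains U where "open U" "U \<noteq> {}"
    "\<And>h h'. h \<in> H \<Longrightarrow> h' \<in> H \<Longrightarrow> h \<noteq> h' \<Longrightarrow> \<alpha> h ` U \<inter> \<alpha> h' ` U = {}"
proof -
  obtain x :: 'x where True by blast
  let ?P = "{(h, h'). h \<in> H \<and> h' \<in> H \<and> h \<noteq> h'}"
  have "\<exists>W. open W \<and> x \<in> W \<and> \<alpha> (fst p) ` W \<inter> \<alpha> (snd p) ` W = {}" if pP: "p \<in> ?P" for p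
  proof -
    obtain h h' where p: "p = (h, h')" "h \<noteq> h'" using pP by blast
    have "\<alpha> h x \<noteq> \<alpha> h' x" using free_action_eq_iff[OF free] p(2) by simp
    then obtain A B where AB: "open A" "open B" "\<alpha> h x \<in> A" "\<alpha> h' x \<in> B" "A \<inter> B = {}"
      by (drule_tac hausdorff) (elim exE conjE, rule that; assumption)
    let ?W = "\<alpha> h -` A \<inter> \<alpha> h' -` B"
    have "open ?W" by (intro open_Int open_vimage AB(1,2) cont_act)
    moreover have "\<alpha> h ` ?W \<subseteq> A" "\<alpha> h' ` ?W \<subseteq> B" by auto
    then have "\<alpha> h ` ?W \<inter> \<alpha> h' ` ?W = {}" using AB(5) by blast
    ultimately show ?thesis using AB(3,4) p by (intro exI[of _ ?W]) simp
  qed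
  then have "\<forall>p\<in>?P. \<exists>W. open W \<and> x \<in> W \<and> \<alpha> (fst p) ` W \<inter> \<alpha> (snd p) ` W = {}" by (rule ballI)
  then obtain W where W: "\<forall>p\<in>?P. open (W p) \<and> x \<in> W p \<and> \<alpha> (fst p) ` W p \<inter> \<alpha> (snd p) ` W p = {}"
    by (rule bchoice[THEN exE])
  have finP: "finite ?P" by (rule finite_subset[of _ "H \<times> H"]) (use fin in auto)
  let ?U = "\<Inter>p\<in>?P. W p"
  show thesis
  proof (rule that[of ?U])
    show "open ?U" by (intro open_INT finP ballI) (use W in blast)
    have "x \<in> ?U" by (intro INT_I) (use W in blast)
    then show "?U \<noteq> {}" by blast
    fix h h' assume "h \<in> H" "h' \<in> H" "h \<noteq> h'"
    then have p: "(h, h') \<in> ?P" by simp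
    then have "?U \<subseteq> W (h, h')" by (rule INF_lower)
    then have "\<alpha> h ` ?U \<inter> \<alpha> h' ` ?U \<subseteq> \<alpha> h ` W (h, h') \<inter> \<alpha> h' ` W (h, h')"
      by (intro Int_mono image_mono)
    moreover have "\<alpha> h ` W (h, h') \<inter> \<alpha> h' ` W (h, h') = {}" using bspec[OF W p] by simp
    ultimately show "\<alpha> h ` ?U \<inter> \<alpha> h' ` ?U = {}" by (simp only: subset_empty)
  qed
qed

text \<open>Orbits are finite, hence closed, so by minimality X is one finite discrete orbit. The
  single tower of shape \<Gamma> over a point fills it, with empty remainder and empty
  \<open>S'\<close>.\<close>

lemma almost_finite_of_finite_group:
  assumes min: "minimal_action \<alpha>" and free: "free_action \<alpha>" and fin: "finite (UNIV :: 'g set)"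
  shows "almost_finite \<alpha>"
proof -
  obtain x :: 'x where True by blast
  let ?Y = "range (\<lambda>g. \<alpha> g x)"
  have "closed ?Y" using fin by (simp add: finite_imp_closed)
  moreover have "\<forall>g. \<alpha> g ` ?Y \<subseteq> ?Y" by (auto simp flip: act_add)
  ultimately have Y: "?Y = UNIV" using min unfolding minimal_action_def by blast
  have finX: "finite (UNIV :: 'x set)" using fin by (simp flip: Y)
  have op: "open {x}"
    using finite_imp_closed[of "- {x}"] finX by (simp add: closed_def finite_subset)
  have orb: "(\<Union>s. \<alpha> s ` {x}) = UNIV" using Y by auto
  have dis: "\<alpha> s ` {x} \<inter> \<alpha> t ` {x} = {}" if "s \<noteq> t" for s t
  proof -
    have "\<alpha> s x \<noteq> \<alpha> t x" using free_action_eq_iff[OF free] that by simp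
    then show ?thesis by simp
  qed
  have sub: "gsubeq G (unit_emb {}) (unit_emb {})"
    by (rule act_subeq_imp_gsubeq, rule act_subeqI[of "{}"]) auto
  show ?thesis
    unfolding almost_finite_def
  proof (intro allI impI, elim conjE)
    fix n :: nat and K :: "'g set" and \<delta> :: real
    assume n: "1 \<le> n" and K: "finite K" and d: "0 < \<delta>"
    show "\<exists>I S V S'. tower_castle \<alpha> I S V \<and> (\<forall>i\<in>I. open (V i)) \<and>
           (\<forall>i\<in>I. invariant_set K \<delta> (S i)) \<and>
           (\<forall>i\<in>I. \<forall>s\<in>S i. diameter (\<alpha> s ` V i) < \<delta>) \<and>
           (\<forall>i\<in>I. S' i \<subseteq> S i \<and> real (card (S' i)) < real (card (S i)) / real n) \<and>
           gsubeq G (unit_emb (UNIV - (\<Union>i\<in>I. \<Union>s\<in>S i. \<alpha> s ` V i)))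
             (unit_emb (\<Union>i\<in>I. \<Union>s\<in>S' i. \<alpha> s ` V i))"
    proof (intro exI conjI)
      show "tower_castle \<alpha> {0} (\<lambda>_. UNIV) (\<lambda>_. {x})"
        using fin dis by (simp add: tower_castle_def)
      show "\<forall>i\<in>{0::nat}. open {x}" using op by simp
      show "\<forall>i\<in>{0::nat}. invariant_set K \<delta> UNIV"
        using d mult_right_mono[of "1 - \<delta>" 1 "real (card (UNIV :: 'g set))"] by (simp add: invariant_set_def)
      show "\<forall>i\<in>{0::nat}. \<forall>s\<in>UNIV. diameter (\<alpha> s ` {x}) < \<delta>" using d by simp
      show "\<forall>i\<in>{0::nat}. {} \<subseteq> (UNIV :: 'g set) \<and> real (card ({} :: 'g set)) < real (card (UNIV :: 'g set)) / real n"
        using n fin by (simp add: card_gt_0_iff)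
      have "UNIV - (\<Union>i\<in>{0::nat}. \<Union>s. \<alpha> s ` {x}) = {}" using orb by simp
      then show "gsubeq G (unit_emb (UNIV - (\<Union>i\<in>{0::nat}. \<Union>s\<in>UNIV. \<alpha> s ` {x})))
           (unit_emb (\<Union>i\<in>{0::nat}. \<Union>s\<in>{}. \<alpha> s ` {x}))"
        using sub by (simp only: UN_empty UN_empty2)
    qed
  qed
qed

end

section \<open>Almost elementary implies almost finite\<close>

lemma tower_unionI:
  "i \<in> I \<Longrightarrow> s \<in> S i \<Longrightarrow> x \<in> \<alpha> s ` V i \<Longrightarrow> x \<in> (\<Union>i\<in>I. \<Union>s\<in>S i. \<alpha> s ` V i)"
  by blast

lemma tower_castleD:
  assumes "tower_castle \<alpha> I S V" "i \<in> I" "j \<in> I" "s \<in> S i" "t \<in> S j" "x \<in> V i" "y \<in> V j" "\<alpha> s x = \<alpha> t y"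
  shows "i = j" "s = t"
proof -
  have ne: "\<alpha> s ` V i \<inter> \<alpha> t ` V j \<noteq> {}"
    using assms(6-8) by (metis IntI empty_iff imageI)
  show ij: "i = j"
  proof (rule ccontr)
    assume "i \<noteq> j"
    then have "\<alpha> s ` V i \<inter> \<alpha> t ` V j = {}" using assms(1-5) unfolding tower_castle_def by simp
    then show False using ne by simp
  qed
  show "s = t"
  proof (rule ccontr)
    assume "s \<noteq> t"
    then have "\<alpha> s ` V i \<inter> \<alpha> t ` V j = {}" using assms(1-5) ij unfolding tower_castle_def by simp
    then show False using ne by simp
  qed
qed

context top_action
begin

text \<open>Take t in the interior Z of T and outside P, so that level t sits in some level s.
  Moving it by \<open>r - s\<close> with r in \<open>S'' i\<close> puts it in a chosen level, and t
  stays in T as the difference lies in K. This is at most m-to-one, so |Z| - |P| \<le> m|Q|. With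
  2|Z| \<ge> |T|, the constant 4(m + 1) in \<open>few\<close> leaves exactly m|P| \<le>
  m|Q|.\<close>

lemma card_bad_levels_le:
  assumes tc: "tower_castle \<alpha> I S V"
    and S'': "\<And>i. i \<in> I \<Longrightarrow> S'' i \<subseteq> S i" "\<And>i. i \<in> I \<Longrightarrow> card (S i) \<le> m * card (S'' i)"
    and m: "m \<ge> 1" and T: "finite T" and U: "U \<noteq> {}"
    and K: "0 \<in> K" "\<And>i a b. i \<in> I \<Longrightarrow> a \<in> S i \<Longrightarrow> b \<in> S i \<Longrightarrow> a - b \<in> K"
  defines "P \<equiv> {t\<in>T. \<not> (\<exists>i\<in>I. \<exists>s\<in>S i. \<alpha> t ` U \<subseteq> \<alpha> s ` V i)}"
  assumes few: "4 * (m + 1) * card P \<le> 2 * card T" and inner: "card T \<le> 2 * card {s. \<forall>k\<in>K. k + s \<in> T}"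
  shows "card P \<le> card {t\<in>T. \<alpha> t ` U \<subseteq> (\<Union>i\<in>I. \<Union>s\<in>S'' i. \<alpha> s ` V i)}"
proof -
  let ?W = "\<Union>i\<in>I. \<Union>s\<in>S'' i. \<alpha> s ` V i"
  let ?Q = "{t\<in>T. \<alpha> t ` U \<subseteq> ?W}"
  define Z where "Z = {s. \<forall>k\<in>K. k + s \<in> T}"
  obtain u where u: "u \<in> U" using U by blast
  have ZT: "Z \<subseteq> T" unfolding Z_def using K(1) by (metis (no_types, lifting) add_0 mem_Collect_eq subsetI)
  have finS: "finite (S i)" if "i \<in> I" for i using tc that unfolding tower_castle_def by simp
  have "\<forall>i\<in>I. \<exists>f. f ` S i \<subseteq> S'' i \<times> {..<m} \<and> inj_on f (S i)"
  proof
    fix i assume i: "i \<in> I"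
    have "finite (S'' i)" using finite_subset[OF S''(1)[OF i] finS[OF i]] .
    then show "\<exists>f. f ` S i \<subseteq> S'' i \<times> {..<m} \<and> inj_on f (S i)"
      using S''(2)[OF i] finS[OF i] by (intro card_le_inj) (simp_all add: card_cartesian_product mult.commute)
  qed
  then obtain f where f: "\<forall>i\<in>I. f i ` S i \<subseteq> S'' i \<times> {..<m} \<and> inj_on (f i) (S i)"
    by (rule bchoice[THEN exE])
  have "\<forall>t\<in>Z - P. \<exists>p. fst p \<in> I \<and> snd p \<in> S (fst p) \<and> \<alpha> t ` U \<subseteq> \<alpha> (snd p) ` V (fst p)"
  proof
    fix t assume "t \<in> Z - P"
    then obtain i s where "i \<in> I" "s \<in> S i" "\<alpha> t ` U \<subseteq> \<alpha> s ` V i" using ZT unfolding P_def by blast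
    then show "\<exists>p. fst p \<in> I \<and> snd p \<in> S (fst p) \<and> \<alpha> t ` U \<subseteq> \<alpha> (snd p) ` V (fst p)"
      by (intro exI[of _ "(i, s)"]) simp
  qed
  then obtain p where p: "\<forall>t\<in>Z - P. fst (p t) \<in> I \<and> snd (p t) \<in> S (fst (p t)) \<and>
      \<alpha> t ` U \<subseteq> \<alpha> (snd (p t)) ` V (fst (p t))"
    by (rule bchoice[THEN exE])
  define i where "i t = fst (p t)" for t
  define s where "s t = snd (p t)" for t
  define r where "r t = fst (f (i t) (s t))" for t
  define k where "k t = snd (f (i t) (s t))" for t
  have iI: "i t \<in> I" and sS: "s t \<in> S (i t)" and lev: "\<alpha> t ` U \<subseteq> \<alpha> (s t) ` V (i t)"
    if "t \<in> Z - P" for t using bspec[OF p that] unfolding i_def s_def by simp_all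
  have fS: "f (i t) (s t) \<in> S'' (i t) \<times> {..<m}" if "t \<in> Z - P" for t
    using bspec[OF f iI[OF that]] sS[OF that] by blast
  have rS'': "r t \<in> S'' (i t)" and km: "k t < m" if "t \<in> Z - P" for t
    using fS[OF that] unfolding r_def k_def by (simp_all add: mem_Times_iff)
  have rS: "r t \<in> S (i t)" if "t \<in> Z - P" for t using rS''[OF that] S''(1)[OF iI[OF that]] by blast
  have img: "\<alpha> (r t - s t + t) y \<in> \<alpha> (r t) ` V (i t)" if "t \<in> Z - P" "y \<in> U" for t y
  proof -
    have "\<alpha> t y \<in> \<alpha> (s t) ` V (i t)" using lev[OF that(1)] that(2) by blast
    then obtain v where v: "v \<in> V (i t)" "\<alpha> t y = \<alpha> (s t) v" by blast
    have "\<alpha> (r t - s t + t) y = \<alpha> (r t) v" by (simp only: act_add v(2) act_diff)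
    then show ?thesis using v(1) by simp
  qed
  have "card (Z - P) \<le> card (?Q \<times> {..<m})"
  proof (rule card_inj_on_le[of "\<lambda>t. (r t - s t + t, k t)"])
    show "finite (?Q \<times> {..<m})" using T by simp
    show "(\<lambda>t. (r t - s t + t, k t)) ` (Z - P) \<subseteq> ?Q \<times> {..<m}"
    proof (rule image_subsetI)
      fix t assume t: "t \<in> Z - P"
      have "r t - s t \<in> K" using K(2)[OF iI[OF t] rS[OF t] sS[OF t]] .
      then have "r t - s t + t \<in> T" using t unfolding Z_def by simp
      moreover have "\<alpha> (r t - s t + t) ` U \<subseteq> ?W"
      proof (rule image_subsetI)
        fix y assume "y \<in> U"
        then have "\<alpha> (r t - s t + t) y \<in> \<alpha> (r t) ` V (i t)" using img[OF t] by blast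
        then show "\<alpha> (r t - s t + t) y \<in> ?W" by (intro UN_I[OF iI[OF t]] UN_I[OF rS''[OF t]])
      qed
      ultimately show "(r t - s t + t, k t) \<in> ?Q \<times> {..<m}" using km[OF t] by simp
    qed
    show "inj_on (\<lambda>t. (r t - s t + t, k t)) (Z - P)"
    proof (rule inj_onI)
      fix t t' assume t: "t \<in> Z - P" and t': "t' \<in> Z - P" and "(r t - s t + t, k t) = (r t' - s t' + t', k t')"
      then have eq: "r t - s t + t = r t' - s t' + t'" and kk: "k t = k t'" by simp_all
      \<comment> \<open>Trace the point u: its image lies in a single level, which recovers the
        tower and r. Together with k this recovers s, and then t.\<close>
      obtain v where v: "v \<in> V (i t)" "\<alpha> (r t - s t + t) u = \<alpha> (r t) v" using img[OF t u] by blast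
      obtain v' where v': "v' \<in> V (i t')" "\<alpha> (r t' - s t' + t') u = \<alpha> (r t') v'" using img[OF t' u] by blast
      have vv: "\<alpha> (r t) v = \<alpha> (r t') v'" using v(2) v'(2) eq by simp
      note e = tower_castleD[OF tc iI[OF t] iI[OF t'] rS[OF t] rS[OF t'] v(1) v'(1) vv]
      have "f (i t) (s t) = f (i t) (s t')"
        using e kk unfolding r_def k_def by (simp add: prod_eq_iff)
      then have "s t = s t'"
        using bspec[OF f iI[OF t]] sS[OF t] sS[OF t'] e(1) by (metis inj_onD)
      then show "t = t'" using eq e(2) by simp
    qed
  qed
  then have 1: "card (Z - P) \<le> m * card ?Q" by (simp add: card_cartesian_product mult.commute)
  have finP: "finite P" unfolding P_def using T by simp
  have finZ: "finite Z" using finite_subset[OF ZT T] .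
  have "card Z \<le> card (Z - P) + card P"
    using card_mono[of "(Z - P) \<union> P" Z] card_Un_le[of "Z - P" P] finZ finP by (simp add: Un_commute)
  then have "card T \<le> 2 * (m * card ?Q) + 2 * card P" using inner 1 unfolding Z_def by linarith
  then have "4 * (m + 1) * card P \<le> 4 * (m * card ?Q) + 4 * card P" using few by linarith
  then have "m * card P \<le> m * card ?Q" by (simp add: algebra_simps)
  then show ?thesis using m by simp
qed

lemma almost_elementary_imp_almost_finite:
  assumes ae: "almost_elementary G" and cpt: "compact (UNIV :: 'x set)" and fol: "folner_condition TYPE('g)"
    and free: "free_action \<alpha>" and inf: "infinite (UNIV :: 'g set)"
  shows "almost_finite \<alpha>"
  unfolding almost_finite_def
proof (intro allI impI, elim conjE)
  fix n :: nat and K :: "'g set" and \<delta> :: real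
  assume n: "1 \<le> n" and K: "finite K" and d: "0 < \<delta>"
  \<comment> \<open>With this m, |S|/m + 2 levels are fewer than |S|/n as soon as |S| \<ge>
    2m.\<close>
  define m where "m = 4 * n"
  have m: "m \<ge> 1" using n by (simp add: m_def)
  \<comment> \<open>Padding K to at least 4m elements forces large shapes: |K1| \<le> |K1 + S| \<le>
    2|S|, so |S| \<ge> 2m.\<close>
  obtain K' :: "'g set" where K': "finite K'" "card K' = 4 * m"
    using infinite_arbitrarily_large[OF inf] by blast
  define K1 where "K1 = insert 0 (K \<union> K')"
  have K1: "finite K1" "0 \<in> K1" "K \<subseteq> K1" "4 * m \<le> card K1"
    using K K' card_mono[of K1 K'] by (auto simp: K1_def)
  obtain H :: "'g set" where H: "finite H" "card H = 4 * (m + 1)"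
    using infinite_arbitrarily_large[OF inf] by blast
  obtain U where U: "open U" "U \<noteq> {}"
    and Udis: "\<And>h h'. h \<in> H \<Longrightarrow> h' \<in> H \<Longrightarrow> h \<noteq> h' \<Longrightarrow> \<alpha> h ` U \<inter> \<alpha> h' ` U = {}"
    by (rule free_action_separating_open[OF free H(1)]) (rule that; (assumption | simp only:))
  have cK1: "card K1 > 0" using K1 m by linarith
  define \<epsilon>1 where "\<epsilon>1 = min 1 (\<delta> / real (card K1))"
  have e1: "\<epsilon>1 > 0" "\<epsilon>1 \<le> 1" "real (card K1) * \<epsilon>1 \<le> \<delta>"
    using d cK1 by (auto simp: \<epsilon>1_def field_simps min_def)
  obtain I S V where tc: "tower_castle \<alpha> I S V"
    and S: "\<And>i. i \<in> I \<Longrightarrow> open (V i) \<and> V i \<noteq> {} \<and> S i \<noteq> {} \<and> real (card (K1 + S i)) \<le> (1 + \<epsilon>1) * real (card (S i))"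
    and dst: "\<And>i s x y. i \<in> I \<Longrightarrow> s \<in> S i \<Longrightarrow> x \<in> V i \<Longrightarrow> y \<in> V i \<Longrightarrow> dist (\<alpha> s x) (\<alpha> s y) < \<delta> / 2"
    and rem: "act_subeq \<alpha> (UNIV - (\<Union>i\<in>I. \<Union>s\<in>S i. \<alpha> s ` V i)) U"
    by (rule almost_elementary_folner_towers[OF ae cpt fol K1(1,2) e1(1) half_gt_zero[OF d] U])
       (rule that; (assumption | simp only:))
  have finI: "finite I" and finS: "\<And>i. i \<in> I \<Longrightarrow> finite (S i)"
    using tc unfolding tower_castle_def by simp_all
  have cardS: "2 * m \<le> card (S i)" if i: "i \<in> I" for i
  proof -
    have "real (card K1) \<le> real (card (K1 + S i))"
      using card_set_plus_right_le[OF K1(1) finS[OF i]] S[OF i] by simp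
    also have "\<dots> \<le> (1 + \<epsilon>1) * real (card (S i))" using S[OF i] by simp
    also have "\<dots> \<le> 2 * real (card (S i))" using e1 by (intro mult_right_mono) simp_all
    finally show ?thesis using K1(4) by linarith
  qed
  \<comment> \<open>Of the two extra levels one compensates rounding, so that m|S''| \<ge> |S|; the
    other is set aside as \<open>r i\<close>.\<close>
  have "\<forall>i\<in>I. \<exists>A. A \<subseteq> S i \<and> card A = card (S i) div m + 2"
  proof
    fix i assume i: "i \<in> I"
    have "card (S i) div m + 2 \<le> card (S i)"
    proof -
      have "card (S i) div m \<le> card (S i) div 4" using m n by (intro div_le_mono2) (auto simp: m_def)
      moreover have "card (S i) \<ge> 8" using cardS[OF i] n by (simp add: m_def)
      ultimately show ?thesis by linarith
    qed
    then show "\<exists>A. A \<subseteq> S i \<and> card A = card (S i) div m + 2"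
      by (meson obtain_subset_with_card_n)
  qed
  then obtain S' where S': "\<forall>i\<in>I. S' i \<subseteq> S i \<and> card (S' i) = card (S i) div m + 2"
    by (rule bchoice[THEN exE])
  define r where "r i = (SOME s. s \<in> S' i)" for i
  define S'' where "S'' i = S' i - {r i}" for i
  have rS': "r i \<in> S' i" if i: "i \<in> I" for i
  proof -
    have "S' i \<noteq> {}" using bspec[OF S' i] by auto
    then show ?thesis unfolding r_def by (simp add: some_in_eq)
  qed
  have S''S: "S'' i \<subseteq> S i" and rS: "r i \<in> S i" if i: "i \<in> I" for i
    using bspec[OF S' i] rS'[OF i] unfolding S''_def by blast+
  have cardS'': "card (S i) \<le> m * card (S'' i)" if i: "i \<in> I" for i
  proof -
    have "card (S'' i) = card (S i) div m + 1"
      using bspec[OF S' i] rS'[OF i] unfolding S''_def by simp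
    moreover have "card (S i) < m * (card (S i) div m) + m"
      using mult_div_mod_eq[of m "card (S i)"] mod_less_divisor[of m "card (S i)"] m by linarith
    ultimately show ?thesis by (simp add: algebra_simps)
  qed
  have cardS': "real (card (S' i)) < real (card (S i)) / real n" if i: "i \<in> I" for i
  proof -
    have "m * (card (S i) div m) \<le> card (S i)" by simp
    then have "4 * (n * card (S' i)) \<le> card (S i) + 2 * m"
      using bspec[OF S' i] by (simp add: m_def algebra_simps)
    also have "\<dots> < 4 * card (S i)" using cardS[OF i] m by linarith
    finally have "n * card (S' i) < card (S i)" by simp
    then have "real n * real (card (S' i)) < real (card (S i))" by (metis of_nat_less_iff of_nat_mult)
    then show ?thesis using n by (simp add: field_simps)
  qed

  obtain J :: "nat set" and B g where J: "finite J" and opB: "\<And>j. j \<in> J \<Longrightarrow> open (B j)"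
    and RB: "UNIV - (\<Union>i\<in>I. \<Union>s\<in>S i. \<alpha> s ` V i) \<subseteq> (\<Union>j\<in>J. B j)"
    and BU: "\<And>j. j \<in> J \<Longrightarrow> \<alpha> (g j) ` B j \<subseteq> U"
    and Bdis: "\<And>i j. i \<in> J \<Longrightarrow> j \<in> J \<Longrightarrow> i \<noteq> j \<Longrightarrow> \<alpha> (g i) ` B i \<inter> \<alpha> (g j) ` B j = {}"
    using rem by (rule act_subeqE) (rule that; (assumption | simp only:))
  define N where "N = (\<Union>j\<in>J. B j)"
  define K2 where "K2 = insert 0 ((H + g ` J) \<union> (\<Union>i\<in>I. (\<lambda>(a, b). a - b) ` (S i \<times> S i)))"
  have K2: "finite K2" "0 \<in> K2" unfolding K2_def using H(1) J finI finS by (auto intro!: finite_set_plus)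
  have K2diff: "a - b \<in> K2" if "i \<in> I" "a \<in> S i" "b \<in> S i" for i a b
    unfolding K2_def using that by (intro insertI2 UnI2 UN_I[of i] image_eqI[of _ _ "(a, b)"]) simp_all
  have cK2: "card K2 > 0" using K2 by (auto simp: card_gt_0_iff)
  \<comment> \<open>Chosen so that at least half of each shape of the second castle is interior for
    \<open>K2\<close>.\<close>
  define \<epsilon>2 where "\<epsilon>2 = 1 / (2 * real (card K2))"
  have e2: "\<epsilon>2 > 0" "\<epsilon>2 \<le> 1" "real (card K2) * \<epsilon>2 = 1 / 2"
    using cK2 by (auto simp: \<epsilon>2_def field_simps)
  have hits: "4 * (m + 1) * card {t\<in>T. \<alpha> t u \<in> N} \<le> 2 * card T"
    if T: "finite T" "real (card (K2 + T)) \<le> (1 + \<epsilon>2) * real (card T)" for T u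
  proof -
    have "4 * (m + 1) * card {t\<in>T. \<alpha> t u \<in> N} \<le> card (H + g ` J + T)"
      using card_hitting_times_le[OF H(1) J T(1) Udis BU Bdis] unfolding N_def H(2) .
    also have "\<dots> \<le> card (K2 + T)"
      using K2(1) T(1) by (intro card_mono finite_set_plus set_plus_mono2) (auto simp: K2_def)
    finally have "real (4 * (m + 1) * card {t\<in>T. \<alpha> t u \<in> N}) \<le> (1 + \<epsilon>2) * real (card T)"
      using T(2) by linarith
    also have "\<dots> \<le> 2 * real (card T)" using e2 by (intro mult_right_mono) simp_all
    finally show ?thesis by linarith
  qed
  \<comment> \<open>Without towers N would be all of X and every time would be a visit,
    contradicting \<open>hits\<close> on any Folner set. A tower is needed to supply the reserved
    level.\<close>
  have "I \<noteq> {}"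
  proof
    assume "I = {}"
    then have N: "N = UNIV" using RB unfolding N_def by auto
    obtain T :: "'g set" where T: "finite T" "T \<noteq> {}" "real (card (K2 + T)) \<le> (1 + \<epsilon>2) * real (card T)"
      using fol K2(1) e2(1) unfolding folner_condition_def by blast
    have "4 * (m + 1) * card T \<le> 2 * card T" using hits[OF T(1,3)] unfolding N by simp
    moreover have "card T > 0" using T by (simp add: card_gt_0_iff)
    ultimately show False by (simp add: algebra_simps)
  qed
  then obtain i0 where i0: "i0 \<in> I" by blast
  define U0 where "U0 = \<alpha> (r i0) ` V i0"
  have U0: "open U0" "U0 \<noteq> {}" using S[OF i0] open_act unfolding U0_def by simp_all

  define \<C> where "\<C> = insert N ((\<lambda>(i, s). \<alpha> s ` V i) ` Sigma I S)"
  have "UNIV \<subseteq> \<Union>\<C>"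
  proof
    fix x :: 'x
    show "x \<in> \<Union>\<C>"
    proof (cases "x \<in> N")
      case False
      then have "x \<in> (\<Union>i\<in>I. \<Union>s\<in>S i. \<alpha> s ` V i)" using RB unfolding N_def by blast
      then obtain i s where "i \<in> I" "s \<in> S i" "x \<in> \<alpha> s ` V i" by blast
      then show ?thesis unfolding \<C>_def by (intro UnionI[of "\<alpha> s ` V i"] insertI2 image_eqI[of _ _ "(i, s)"]) simp_all
    qed (simp add: \<C>_def)
  qed
  moreover have "open C" if "C \<in> \<C>" for C
    using that opB S open_act unfolding \<C>_def N_def by (auto intro!: open_UN)
  ultimately obtain \<eta> where eta: "\<eta> > 0" and leb: "\<And>x. x \<in> UNIV \<Longrightarrow> \<exists>C\<in>\<C>. ball x \<eta> \<subseteq> C"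
    using Heine_Borel_lemma[OF cpt] by blast
  obtain I2 T U2 where tc2: "tower_castle \<alpha> I2 T U2"
    and T: "\<And>l. l \<in> I2 \<Longrightarrow> open (U2 l) \<and> U2 l \<noteq> {} \<and> T l \<noteq> {} \<and> real (card (K2 + T l)) \<le> (1 + \<epsilon>2) * real (card (T l))"
    and dst2: "\<And>l s x y. l \<in> I2 \<Longrightarrow> s \<in> T l \<Longrightarrow> x \<in> U2 l \<Longrightarrow> y \<in> U2 l \<Longrightarrow> dist (\<alpha> s x) (\<alpha> s y) < \<eta>"
    and rem2: "act_subeq \<alpha> (UNIV - (\<Union>l\<in>I2. \<Union>s\<in>T l. \<alpha> s ` U2 l)) U0"
    by (rule almost_elementary_folner_towers[OF ae cpt fol K2 e2(1) eta U0])
       (rule that; (assumption | simp only:))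
  have finT: "finite (T l)" if "l \<in> I2" for l using tc2 that unfolding tower_castle_def by simp
  define W where "W = (\<Union>i\<in>I. \<Union>s\<in>S'' i. \<alpha> s ` V i)"
  define P where "P l = {t\<in>T l. \<not> (\<exists>i\<in>I. \<exists>s\<in>S i. \<alpha> t ` U2 l \<subseteq> \<alpha> s ` V i)}" for l
  define Q where "Q l = {t\<in>T l. \<alpha> t ` U2 l \<subseteq> W}" for l
  have PQ: "card (P l) \<le> card (Q l)" if l: "l \<in> I2" for l
    unfolding P_def Q_def W_def
  proof (rule card_bad_levels_le[OF tc S''S cardS'' m finT[OF l] _ K2(2) K2diff])
    show "U2 l \<noteq> {}" using T[OF l] by simp
    then obtain u where u: "u \<in> U2 l" by blast
    \<comment> \<open>The whole level lies within \<eta> of its point over u, hence in one member of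
      the cover. For t in \<open>P l\<close> that member cannot be a level of the first castle, so
      it is N.\<close>
    have "P l \<subseteq> {t\<in>T l. \<alpha> t u \<in> N}"
    proof
      fix t assume t: "t \<in> P l"
      then have tT: "t \<in> T l" unfolding P_def by simp
      obtain C where C: "C \<in> \<C>" "ball (\<alpha> t u) \<eta> \<subseteq> C" using leb by blast
      have sub: "\<alpha> t ` U2 l \<subseteq> C"
        using C(2) dst2[OF l tT u] by (auto simp: subset_iff)
      have "C = N"
      proof (rule ccontr)
        assume "C \<noteq> N"
        then obtain i s where "i \<in> I" "s \<in> S i" "C = \<alpha> s ` V i" using C(1) unfolding \<C>_def by blast
        then show False using t sub unfolding P_def by blast
      qed
      then show "t \<in> {t\<in>T l. \<alpha> t u \<in> N}" using sub u tT by blast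
    qed
    then have "card (P l) \<le> card {t\<in>T l. \<alpha> t u \<in> N}" using finT[OF l] by (intro card_mono) simp_all
    then have "4 * (m + 1) * card (P l) \<le> 4 * (m + 1) * card {t\<in>T l. \<alpha> t u \<in> N}" by (rule mult_le_mono2)
    also have "\<dots> \<le> 2 * card (T l)" using hits[OF finT[OF l]] T[OF l] by blast
    finally show "4 * (m + 1) * card {t\<in>T l. \<not> (\<exists>i\<in>I. \<exists>s\<in>S i. \<alpha> t ` U2 l \<subseteq> \<alpha> s ` V i)} \<le> 2 * card (T l)"
      unfolding P_def .
    have "(1 - real (card K2) * \<epsilon>2) * real (card (T l)) \<le> real (card {s. \<forall>k\<in>K2. k + s \<in> T l})"
      using card_interior_ge[OF K2 finT[OF l]] T[OF l] by blast
    then show "card (T l) \<le> 2 * card {s. \<forall>k\<in>K2. k + s \<in> T l}" unfolding e2(3) by simp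
  qed
  have PT: "P l \<subseteq> T l" and QT: "Q l \<subseteq> T l" for l unfolding P_def Q_def by blast+
  have U2: "open (U2 l)" if "l \<in> I2" for l using T[OF that] by simp
  have "act_subeq \<alpha> (\<Union>l\<in>I2. \<Union>t\<in>P l. \<alpha> t ` U2 l) (\<Union>l\<in>I2. \<Union>t\<in>Q l. \<alpha> t ` U2 l)"
    by (rule act_subeq_tower_levels[OF tc2 U2 PT QT PQ])
  then have "act_subeq \<alpha> (\<Union>l\<in>I2. \<Union>t\<in>P l. \<alpha> t ` U2 l) W"
    by (rule act_subeq_mono) (auto simp: Q_def)
  moreover have "W \<inter> U0 = {}"
  proof (rule ccontr)
    assume "W \<inter> U0 \<noteq> {}"
    then obtain i s x y where *: "i \<in> I" "s \<in> S'' i" "x \<in> V i" "y \<in> V i0" "\<alpha> s x = \<alpha> (r i0) y"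
      unfolding W_def U0_def by blast
    have sS: "s \<in> S i" using S''S[OF *(1)] *(2) by blast
    have "i = i0" "s = r i0" using tower_castleD[OF tc *(1) i0 sS rS[OF i0] *(3,4,5)] .
    then show False using *(2) unfolding S''_def by simp
  qed
  ultimately have "act_subeq \<alpha> ((\<Union>l\<in>I2. \<Union>t\<in>P l. \<alpha> t ` U2 l) \<union> (UNIV - (\<Union>l\<in>I2. \<Union>s\<in>T l. \<alpha> s ` U2 l))) (W \<union> U0)"
    using rem2 by (intro act_subeq_Un)
  then have "act_subeq \<alpha> (UNIV - (\<Union>i\<in>I. \<Union>s\<in>S i. \<alpha> s ` V i)) (\<Union>i\<in>I. \<Union>s\<in>S' i. \<alpha> s ` V i)"
  proof (rule act_subeq_mono)
    \<comment> \<open>A level of the second castle that meets the first remainder lies in no level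
      of the first castle, so its index is in \<open>P l\<close>.\<close>
    show "UNIV - (\<Union>i\<in>I. \<Union>s\<in>S i. \<alpha> s ` V i) \<subseteq>
       (\<Union>l\<in>I2. \<Union>t\<in>P l. \<alpha> t ` U2 l) \<union> (UNIV - (\<Union>l\<in>I2. \<Union>s\<in>T l. \<alpha> s ` U2 l))"
    proof
      fix x assume x: "x \<in> UNIV - (\<Union>i\<in>I. \<Union>s\<in>S i. \<alpha> s ` V i)"
      show "x \<in> (\<Union>l\<in>I2. \<Union>t\<in>P l. \<alpha> t ` U2 l) \<union> (UNIV - (\<Union>l\<in>I2. \<Union>s\<in>T l. \<alpha> s ` U2 l))"
      proof (cases "x \<in> (\<Union>l\<in>I2. \<Union>s\<in>T l. \<alpha> s ` U2 l)")
        case True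
        then obtain l t where l: "l \<in> I2" "t \<in> T l" "x \<in> \<alpha> t ` U2 l" by blast
        have "\<not> \<alpha> t ` U2 l \<subseteq> \<alpha> s ` V i" if "i \<in> I" "s \<in> S i" for i s
          using x subsetD[OF _ l(3)] tower_unionI[OF that(1), of s S x \<alpha> V, OF that(2)] by blast
        then have "t \<in> P l" using l(2) unfolding P_def by simp
        then show ?thesis using tower_unionI[OF l(1), of t P x \<alpha> U2] l(3) by simp
      qed simp
    qed
    have "W \<subseteq> (\<Union>i\<in>I. \<Union>s\<in>S' i. \<alpha> s ` V i)"
      unfolding W_def S''_def by (intro UN_mono) auto
    moreover have "U0 \<subseteq> (\<Union>i\<in>I. \<Union>s\<in>S' i. \<alpha> s ` V i)"
      unfolding U0_def using tower_unionI[OF i0, of "r i0" S' _ \<alpha> V, OF rS'[OF i0]] by (rule subsetI)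
    ultimately show "W \<union> U0 \<subseteq> (\<Union>i\<in>I. \<Union>s\<in>S' i. \<alpha> s ` V i)" by (rule Un_least)
  qed
  then have sub: "gsubeq G (unit_emb (UNIV - (\<Union>i\<in>I. \<Union>s\<in>S i. \<alpha> s ` V i)))
      (unit_emb (\<Union>i\<in>I. \<Union>s\<in>S' i. \<alpha> s ` V i))"
    by (rule act_subeq_imp_gsubeq)
  \<comment> \<open>The interior for \<open>K1\<close> is contained in the one for K; the latter may
    be infinite, which \<open>invariant_set\<close> admits.\<close>
  have inv: "invariant_set K \<delta> (S i)" if i: "i \<in> I" for i
  proof -
    let ?A = "{s. \<forall>t\<in>K. t + s \<in> S i}" and ?Z = "{s. \<forall>t\<in>K1. t + s \<in> S i}"
    have "(1 - \<delta>) * real (card (S i)) \<le> (1 - real (card K1) * \<epsilon>1) * real (card (S i))"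
      using e1(3) by (intro mult_right_mono) simp_all
    also have "\<dots> \<le> real (card ?Z)"
      using card_interior_ge[OF K1(1,2) finS[OF i]] S[OF i] by blast
    finally have Z: "(1 - \<delta>) * real (card (S i)) \<le> real (card ?Z)" .
    have "card ?Z \<le> card ?A" if "finite ?A" using that K1(3) by (intro card_mono) auto
    then show ?thesis using Z unfolding invariant_set_def Let_def by linarith
  qed
  have diam: "diameter (\<alpha> s ` V i) < \<delta>" if i: "i \<in> I" "s \<in> S i" for i s
    using dst[OF i] d by (intro diameter_less_of_dist_less) auto
  show "\<exists>I S V S'. tower_castle \<alpha> I S V \<and> (\<forall>i\<in>I. open (V i)) \<and>
           (\<forall>i\<in>I. invariant_set K \<delta> (S i)) \<and>
           (\<forall>i\<in>I. \<forall>s\<in>S i. diameter (\<alpha> s ` V i) < \<delta>) \<and>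
           (\<forall>i\<in>I. S' i \<subseteq> S i \<and> real (card (S' i)) < real (card (S i)) / real n) \<and>
           gsubeq G (unit_emb (UNIV - (\<Union>i\<in>I. \<Union>s\<in>S i. \<alpha> s ` V i)))
             (unit_emb (\<Union>i\<in>I. \<Union>s\<in>S' i. \<alpha> s ` V i))"
    using tc S inv diam S' cardS' sub by (intro exI[of _ I] exI[of _ S] exI[of _ V] exI[of _ S'] conjI ballI) simp_all
qed

end

section \<open>Almost finite implies almost elementary\<close>

context top_action
begin

text \<open>The points whose orbits avoid U form a closed invariant set other than X, so there are
  none; compactness then bounds the hitting times.\<close>

lemma minimal_action_finite_hitting:
  assumes min: "minimal_action \<alpha>" and cpt: "compact (UNIV :: 'x set)" and U: "open U" "U \<noteq> {}"
  obtains H where "finite H" "H \<noteq> {}" "\<And>x. \<exists>h\<in>H. \<alpha> h x \<in> U"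
proof -
  let ?Y = "- (\<Union>h. \<alpha> h -` U)"
  have op: "open (\<alpha> h -` U)" for h using U(1) cont_act by (rule open_vimage)
  have "closed ?Y" using op by (intro closed_Compl open_UN) simp
  moreover have "\<forall>g. \<alpha> g ` ?Y \<subseteq> ?Y" by (auto simp flip: act_add)
  ultimately have "?Y = {} \<or> ?Y = UNIV" using min[unfolded minimal_action_def, rule_format, of ?Y] by blast
  moreover obtain u where "u \<in> U" using U(2) by blast
  then have "u \<notin> ?Y" by (auto intro: exI[of _ 0])
  then have "?Y \<noteq> UNIV" by blast
  ultimately have "UNIV \<subseteq> (\<Union>h\<in>UNIV. \<alpha> h -` U)" by blast
  then obtain H where H: "finite H" "UNIV \<subseteq> (\<Union>h\<in>H. \<alpha> h -` U)"
    using compactE_image[OF cpt, of UNIV "\<lambda>h. \<alpha> h -` U"] op by metis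
  have hit: "\<exists>h\<in>H. \<alpha> h x \<in> U" for x using H(2) by blast
  then have "H \<noteq> {}" by blast
  then show thesis using that H(1) hit by blast
qed

text \<open>X is nonempty. This guarantees that a castle provided by almost finiteness has a
  tower.\<close>

lemma not_act_subeq_UNIV_empty: "\<not> act_subeq \<alpha> UNIV {}"
proof
  assume "act_subeq \<alpha> UNIV {}"
  then show False
  proof (rule act_subeqE)
    fix J :: "nat set" and B g
    assume "UNIV \<subseteq> (\<Union>j\<in>J. B j)" "\<And>j. j \<in> J \<Longrightarrow> \<alpha> (g j) ` B j \<subseteq> {}"
    then show False by auto
  qed
qed

text \<open>The remainder is closed in a compact space, so both forms of subequivalence agree on it.
  As 0 is in K, interiors lie in the finite shapes, which excludes the infinite alternative of
  \<open>invariant_set\<close>; the strict bound on \<open>S'\<close> makes shapes nonempty.\<close>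

lemma almost_finiteE:
  assumes af: "almost_finite \<alpha>" and cpt: "compact (UNIV :: 'x set)"
    and n: "n \<ge> 1" and K: "finite K" "0 \<in> K" and d: "\<delta> > 0"
  obtains I S V S' where "tower_castle \<alpha> I S V" "I \<noteq> {}" "\<And>i. i \<in> I \<Longrightarrow> open (V i)"
    "\<And>i. i \<in> I \<Longrightarrow> S i \<noteq> {}"
    "\<And>i. i \<in> I \<Longrightarrow> (1 - \<delta>) * real (card (S i)) \<le> real (card {s. \<forall>t\<in>K. t + s \<in> S i})"
    "\<And>i s x y. i \<in> I \<Longrightarrow> s \<in> S i \<Longrightarrow> x \<in> \<alpha> s ` V i \<Longrightarrow> y \<in> \<alpha> s ` V i \<Longrightarrow> dist x y < \<delta>"
    "\<And>i. i \<in> I \<Longrightarrow> S' i \<subseteq> S i"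
    "\<And>i. i \<in> I \<Longrightarrow> real n * real (card (S' i)) < real (card (S i))"
    "act_subeq \<alpha> (UNIV - (\<Union>i\<in>I. \<Union>s\<in>S i. \<alpha> s ` V i)) (\<Union>i\<in>I. \<Union>s\<in>S' i. \<alpha> s ` V i)"
proof -
  have "n \<ge> 1 \<and> finite K \<and> \<delta> > 0" using n K d by simp
  from af[unfolded almost_finite_def, rule_format, OF this]
  obtain I S V S' where tc: "tower_castle \<alpha> I S V" and op: "\<forall>i\<in>I. open (V i)"
    and inv: "\<forall>i\<in>I. invariant_set K \<delta> (S i)"
    and diam: "\<forall>i\<in>I. \<forall>s\<in>S i. diameter (\<alpha> s ` V i) < \<delta>"
    and S': "\<forall>i\<in>I. S' i \<subseteq> S i \<and> real (card (S' i)) < real (card (S i)) / real n"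
    and sub: "gsubeq G (unit_emb (UNIV - (\<Union>i\<in>I. \<Union>s\<in>S i. \<alpha> s ` V i)))
             (unit_emb (\<Union>i\<in>I. \<Union>s\<in>S' i. \<alpha> s ` V i))"
    by (elim exE conjE) (rule that; assumption)
  have finS: "finite (S i)" if "i \<in> I" for i using tc that unfolding tower_castle_def by simp
  have "open (\<Union>i\<in>I. \<Union>s\<in>S i. \<alpha> s ` V i)"
    using op by (intro open_UN ballI open_act) simp
  then have "compact (UNIV - (\<Union>i\<in>I. \<Union>s\<in>S i. \<alpha> s ` V i))" using cpt by (rule compact_diff[rotated])
  with sub have rem: "act_subeq \<alpha> (UNIV - (\<Union>i\<in>I. \<Union>s\<in>S i. \<alpha> s ` V i)) (\<Union>i\<in>I. \<Union>s\<in>S' i. \<alpha> s ` V i)"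
    by (rule gsubeq_imp_act_subeq)
  show thesis
  proof (rule that[OF tc])
    show "I \<noteq> {}" using rem not_act_subeq_UNIV_empty by auto
    show "open (V i)" if "i \<in> I" for i using op that by simp
    show card: "real n * real (card (S' i)) < real (card (S i))" if "i \<in> I" for i
      using bspec[OF S' that] n by (simp add: field_simps)
    show "S i \<noteq> {}" if "i \<in> I" for i
    proof
      assume "S i = {}"
      then have "real n * real (card (S' i)) < 0" using card[OF that] by simp
      moreover have "0 \<le> real n * real (card (S' i))" by simp
      ultimately show False by linarith
    qed
    show "S' i \<subseteq> S i" if "i \<in> I" for i using bspec[OF S' that] by simp
    show "(1 - \<delta>) * real (card (S i)) \<le> real (card {s. \<forall>t\<in>K. t + s \<in> S i})" if i: "i \<in> I" for i
    proof -
      have "{s. \<forall>t\<in>K. t + s \<in> S i} \<subseteq> S i" using K(2) by force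
      then have "finite {s. \<forall>t\<in>K. t + s \<in> S i}" using finS[OF i] by (rule finite_subset)
      then show ?thesis using bspec[OF inv i] unfolding invariant_set_def Let_def by simp
    qed
    show "dist x y < \<delta>" if i: "i \<in> I" "s \<in> S i" and xy: "x \<in> \<alpha> s ` V i" "y \<in> \<alpha> s ` V i" for i s x y
    proof -
      have "bounded (\<alpha> s ` V i)" using compact_imp_bounded[OF cpt] by (rule bounded_subset) simp
      then have "dist x y \<le> diameter (\<alpha> s ` V i)" using xy by (rule diameter_bounded_bound)
      then show ?thesis using diam i by force
    qed
  qed (rule rem)
qed

text \<open>A single shape S, spread along the orbit of any point, serves as F. Only elements of S
  outside the interior A contribute to the boundary, each at most |L| products and itself, whence
  \<delta> = \<epsilon>/(|L| + 1).\<close>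

lemma almost_finite_imp_fiberwise_amenable:
  assumes af: "almost_finite \<alpha>" and cpt: "compact (UNIV :: 'x set)"
  shows "fiberwise_amenable G"
  unfolding fiberwise_amenable_def
proof (intro allI impI)
  fix K \<epsilon> assume "K \<subseteq> gcarrier G \<and> compactin (gtop G) K" and eps: "(\<epsilon>::real) > 0"
  then have "compactin (gtop G) K" by simp
  then obtain L where L: "finite L" "0 \<in> L" "K \<subseteq> {arr g x | g x. g \<in> L}"
    by (rule compactin_gtop_finite)
  define \<delta> where "\<delta> = \<epsilon> / (real (card L) + 1)"
  have d: "\<delta> > 0" "(real (card L) + 1) * \<delta> = \<epsilon>" using eps by (auto simp: \<delta>_def add_pos_nonneg field_simps)
  obtain S where S: "finite S" "S \<noteq> {}"
    and inv: "(1 - \<delta>) * real (card S) \<le> real (card {s. \<forall>t\<in>L. t + s \<in> S})"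
  proof (rule almost_finiteE[OF af cpt order_refl L(1,2) d(1)])
    fix I S V S'
    assume tc: "tower_castle \<alpha> I S V" and I: "I \<noteq> {}" and ne: "\<And>i. i \<in> I \<Longrightarrow> S i \<noteq> {}"
      and inv: "\<And>i. i \<in> I \<Longrightarrow> (1 - \<delta>) * real (card (S i)) \<le> real (card {s. \<forall>t\<in>L. t + s \<in> S i})"
    obtain i where i: "i \<in> I" using I by blast
    have "finite (S i)" using tc i unfolding tower_castle_def by simp
    then show thesis using that ne[OF i] inv[OF i] by blast
  qed
  define A where "A = {s. \<forall>t\<in>L. t + s \<in> S}"
  have AS: "A \<subseteq> S" using L(2) unfolding A_def by force
  have finA: "finite A" using finite_subset[OF AS S(1)] .
  have bad: "real (card (S - A)) \<le> \<delta> * real (card S)"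
    using inv card_mono[OF S(1) AS] unfolding A_def[symmetric]
    by (simp add: card_Diff_subset[OF finA AS] of_nat_diff algebra_simps)
  obtain x :: 'x where True by blast
  let ?\<phi> = "\<lambda>s. arr s x"
  define F where "F = ?\<phi> ` S"
  have cardF: "card F = card S" unfolding F_def by (intro card_image inj_onI) simp
  have "gboundary G K F \<subseteq> ?\<phi> ` ((L + (S - A)) \<union> (S - A))"
  proof
    fix p assume "p \<in> gboundary G K F"
    then consider "p \<in> gsetprod G K F" "p \<notin> F" | y where "p \<in> F" "y \<in> K" "gsrc G y = grng G p" "gmult G y p \<notin> F"
      unfolding gboundary_def by blast
    then show "p \<in> ?\<phi> ` ((L + (S - A)) \<union> (S - A))"
    proof cases
      case 1
      obtain z g v where p: "p = (z, g, v)" by (cases p)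
      from 1(1)[unfolded p] obtain h k y where 2: "(z, h, y) \<in> K" "(y, k, v) \<in> F" "g = h + k"
        by (rule gsetprodE)
      have k: "k \<in> S" "y = \<alpha> k x" "v = x" using 2(2) unfolding F_def by auto
      have h: "h \<in> L" "z = \<alpha> h y" using 2(1) L(3) by auto
      have e: "p = arr (h + k) x" using p 2(3) k h by (simp add: act_add)
      then have "h + k \<notin> S" using 1(2) unfolding F_def by blast
      then have "k \<in> S - A" using h(1) k(1) unfolding A_def by blast
      then have "h + k \<in> L + (S - A)" using h(1) by (intro set_plus_intro)
      then show ?thesis unfolding e by blast
    next
      case 2
      obtain s where s: "s \<in> S" "p = arr s x" using 2(1) unfolding F_def by blast
      obtain h w where h: "h \<in> L" "y = arr h w" using 2(2) L(3) by blast
      have w: "w = \<alpha> s x" using 2(3) s h by simp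
      have "gmult G y p = arr (h + s) x" using s h w by (simp add: act_add)
      then have "h + s \<notin> S" using 2(4) unfolding F_def by auto
      then have "s \<in> S - A" using h(1) s(1) unfolding A_def by blast
      then show ?thesis unfolding s(2) by blast
    qed
  qed
  moreover have fin: "finite ((L + (S - A)) \<union> (S - A))" using L(1) S(1) by (simp add: finite_set_plus)
  ultimately have "card (gboundary G K F) \<le> card (?\<phi> ` ((L + (S - A)) \<union> (S - A)))"
    by (intro card_mono) simp_all
  also have "\<dots> \<le> card ((L + (S - A)) \<union> (S - A))" using fin by (rule card_image_le)
  also have "\<dots> \<le> card (L + (S - A)) + card (S - A)" by (rule card_Un_le)
  also have "\<dots> \<le> card L * card (S - A) + card (S - A)"
    using card_set_plus_le[OF L(1), of "S - A"] S(1) by simp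
  finally have "real (card (gboundary G K F)) \<le> real (card L * card (S - A) + card (S - A))"
    by (rule of_nat_mono)
  also have "\<dots> = (real (card L) + 1) * real (card (S - A))" by (simp add: algebra_simps)
  also have "\<dots> \<le> (real (card L) + 1) * (\<delta> * real (card S))"
    using bad by (intro mult_left_mono) simp_all
  also have "\<dots> = \<epsilon> * real (card F)" unfolding cardF d(2)[symmetric] by simp
  finally have "real (card (gboundary G K F)) \<le> \<epsilon> * real (card F)" .
  moreover have "F \<subseteq> gcarrier G" "finite F" "F \<noteq> {}" using S unfolding F_def by auto
  ultimately show "\<exists>F\<subseteq>gcarrier G. finite F \<and> F \<noteq> {} \<and> real (card (gboundary G K F)) \<le> \<epsilon> * real (card F)"
    by blast
qed

text \<open>The matrix unit (s, t) of a tower: the arrows from level t to level s. Parametrizing by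
  the base makes two of them compose exactly over equal base points.\<close>

definition tower_bisection :: "'x set \<Rightarrow> 'g \<Rightarrow> 'g \<Rightarrow> ('x \<times> 'g \<times> 'x) set" where
  "tower_bisection V s t = (\<lambda>v. (\<alpha> s v, s - t, \<alpha> t v)) ` V"

lemma openin_tower_bisection:
  assumes "open V"
  shows "openin (gtop G) (tower_bisection V s t)"
proof -
  have "{x. arr g x \<in> tower_bisection V s t} = (if g = s - t then \<alpha> t ` V else {})" for g
    unfolding tower_bisection_def by auto
  moreover have "tower_bisection V s t \<subseteq> {arr g x | g x. True}"
  proof
    fix p assume "p \<in> tower_bisection V s t"
    then obtain v where "p = (\<alpha> s v, s - t, \<alpha> t v)" unfolding tower_bisection_def by blast
    then have "p = arr (s - t) (\<alpha> t v)" by simp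
    then show "p \<in> {arr g x | g x. True}" by blast
  qed
  ultimately show ?thesis using open_act[OF assms] by (simp add: openin_gtop_iff)
qed

lemma bisection_tower_bisection: "bisection G (tower_bisection V s t)"
proof -
  have "tower_bisection V s t \<subseteq> {arr g x | g x. True}"
    using openin_gtop_iff[of "tower_bisection UNIV s t"] openin_tower_bisection[of UNIV s t]
    unfolding tower_bisection_def by auto
  then show ?thesis
    unfolding bisection_def by (auto simp: tower_bisection_def inj_on_def)
qed

lemma tower_bisection_diag: "tower_bisection V s s = unit_emb (\<alpha> s ` V)"
  by (simp add: tower_bisection_def unit_emb_def image_image)

lemma tower_bisection_mult:
  "gsetprod G (tower_bisection V r s) (tower_bisection V s t) = tower_bisection V r t"
proof (intro set_eqI iffI)
  fix p assume a: "p \<in> gsetprod G (tower_bisection V r s) (tower_bisection V s t)"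
  obtain z g x where p: "p = (z, g, x)" by (cases p)
  from a[unfolded p] obtain h k y where 1: "(z, h, y) \<in> tower_bisection V r s" "(y, k, x) \<in> tower_bisection V s t" "g = h + k"
    by (rule gsetprodE)
  obtain v where v: "v \<in> V" "z = \<alpha> r v" "h = r - s" "y = \<alpha> s v" using 1(1) unfolding tower_bisection_def by blast
  obtain w where w: "w \<in> V" "y = \<alpha> s w" "k = s - t" "x = \<alpha> t w" using 1(2) unfolding tower_bisection_def by blast
  have "v = w" using v w by simp
  moreover have "g = r - t" using 1(3) v w by (simp add: add_diff_eq)
  ultimately show "p \<in> tower_bisection V r t" using v w unfolding p tower_bisection_def by simp
next
  fix p assume "p \<in> tower_bisection V r t"
  then obtain v where v: "v \<in> V" "p = (\<alpha> r v, r - t, \<alpha> t v)" unfolding tower_bisection_def by blast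
  have "(\<alpha> r v, (r - s) + (s - t), \<alpha> t v) \<in> gsetprod G (tower_bisection V r s) (tower_bisection V s t)"
    using v(1) by (intro gsetprodI[of _ _ "\<alpha> s v"]) (simp_all add: tower_bisection_def)
  then show "p \<in> gsetprod G (tower_bisection V r s) (tower_bisection V s t)"
    using v(2) by (simp add: add_diff_eq)
qed

text \<open>Castles are indexed by naturals, so shapes are coded by e with left inverse d. Arrows
  composable across two towers would give a point in levels of both.\<close>

lemma open_castle_of_towers:
  assumes tc: "tower_castle \<alpha> I S V" and op: "\<And>i. i \<in> I \<Longrightarrow> open (V i)" and d: "\<And>s. d (e s) = s"
  shows "open_castle G I (\<lambda>l. e ` S l) (\<lambda>l i j. tower_bisection (V l) (d i) (d j))"
proof -
  let ?D = "\<lambda>l i j. tower_bisection (V l) (d i) (d j)"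
  have "multisection G (e ` S l) (?D l)" if l: "l \<in> I" for l
    unfolding multisection_def
  proof (intro conjI ballI impI)
    show "finite (e ` S l)" using tc l unfolding tower_castle_def by simp
    show "?D l i i \<subseteq> gunits G" for i unfolding tower_bisection_diag gunits_eq unit_emb_def by blast
    show "?D l i i \<inter> ?D l j j = {}" if ij: "i \<in> e ` S l" "j \<in> e ` S l" "i \<noteq> j" for i j
    proof -
      obtain s t where st: "s \<in> S l" "t \<in> S l" "i = e s" "j = e t" using ij by blast
      then have "s \<noteq> t" using ij(3) by blast
      then have "\<alpha> s ` V l \<inter> \<alpha> t ` V l = {}" using tc l st unfolding tower_castle_def by simp
      then show ?thesis unfolding tower_bisection_diag st d unit_emb_def by auto
    qed
  qed (rule bisection_tower_bisection, rule tower_bisection_mult)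
  moreover have "gsetprod G (?D l i j) (?D l' i' j') = {}"
    if l: "l \<in> I" "l' \<in> I" "l \<noteq> l'" and ij: "i \<in> e ` S l" "j \<in> e ` S l" "i' \<in> e ` S l'" "j' \<in> e ` S l'"
    for l l' i j i' j'
  proof (rule ccontr)
    assume "gsetprod G (?D l i j) (?D l' i' j') \<noteq> {}"
    then obtain z g x where "(z, g, x) \<in> gsetprod G (?D l i j) (?D l' i' j')" by (metis ex_in_conv prod_cases3)
    then obtain h k y where 1: "(z, h, y) \<in> ?D l i j" "(y, k, x) \<in> ?D l' i' j'" by (rule gsetprodE)
    obtain v where v: "v \<in> V l" "y = \<alpha> (d j) v" using 1(1) unfolding tower_bisection_def by blast
    obtain w where w: "w \<in> V l'" "y = \<alpha> (d i') w" using 1(2) unfolding tower_bisection_def by blast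
    have "d j \<in> S l" "d i' \<in> S l'" using ij d by auto
    then have "l = l'" using tower_castleD(1)[OF tc l(1,2) _ _ v(1) w(1)] v(2) w(2) by metis
    then show False using l(3) by simp
  qed
  moreover have "finite I" using tc unfolding tower_castle_def by simp
  moreover have "openin (gtop G) (?D l i j)" if "l \<in> I" for l i j
    using openin_tower_bisection[OF op[OF that]] .
  ultimately show ?thesis unfolding open_castle_def castle_def by simp
qed

lemma almost_finite_imp_almost_elementary:
  assumes af: "almost_finite \<alpha>" and cpt: "compact (UNIV :: 'x set)" and min: "minimal_action \<alpha>"
    and cnt: "countable (UNIV :: 'g set)"
  shows "almost_elementary G"
  unfolding almost_elementary_def
proof (intro allI impI, elim conjE)
  fix K U' \<V>
  assume K: "compactin (gtop G) K" and U': "openin (gtop G) U'" "U' \<subseteq> gunits G" "U' \<noteq> {}"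
    and \<V>: "\<forall>V\<in>\<V>. openin (gtop G) V \<and> V \<subseteq> gunits G" "gunits G \<subseteq> \<Union>\<V>"
  define U where "U = {x. (x, 0, x) \<in> U'}"
  have U'eq: "U' = unit_emb U" using U'(2) unfolding gunits_eq U_def unit_emb_def by auto
  have U: "open U" "U \<noteq> {}"
    using U'(1,3) unfolding U'eq openin_gtop_unit_emb by (auto simp: unit_emb_def)
  obtain x0 where x0: "x0 \<in> U" using U(2) by blast
  obtain \<rho>' where \<rho>': "\<rho>' > 0" "ball x0 \<rho>' \<subseteq> U" using U(1) x0 by (rule openE)
  \<comment> \<open>Half the radius, so that a level of diameter below \<rho> that meets the smaller
    ball stays inside U.\<close>
  define \<rho> where "\<rho> = \<rho>' / 2"
  have \<rho>: "\<rho> > 0" using \<rho>' by (simp add: \<rho>_def)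
  obtain H where H: "finite H" "H \<noteq> {}" and hit: "\<And>x. \<exists>h\<in>H. \<alpha> h x \<in> ball x0 \<rho>"
    using minimal_action_finite_hitting[OF min cpt, of "ball x0 \<rho>"] \<rho> by auto
  obtain L where L: "finite L" "0 \<in> L" "K \<subseteq> {arr g x | g x. g \<in> L}"
    using K by (rule compactin_gtop_finite)
  let ?u = "\<lambda>V. {x. (x, 0, x) \<in> V}"
  have "UNIV \<subseteq> \<Union>(?u ` \<V>)"
  proof
    fix x :: 'x
    have "(x, 0, x) \<in> gunits G" unfolding gunits_eq unit_emb_def by blast
    then show "x \<in> \<Union>(?u ` \<V>)" using \<V>(2) by blast
  qed
  moreover have "open C" if "C \<in> ?u ` \<V>" for C
  proof -
    obtain V where V: "V \<in> \<V>" "C = ?u V" using \<open>C \<in> ?u ` \<V>\<close> by blast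
    have "openin (gtop G) V" using bspec[OF \<V>(1) V(1)] by simp
    then have "open {x. arr 0 x \<in> V}" unfolding openin_gtop_iff by blast
    then show ?thesis using V(2) by simp
  qed
  ultimately obtain \<eta> where eta: "\<eta> > 0" and leb: "\<And>x. x \<in> UNIV \<Longrightarrow> \<exists>C\<in>?u ` \<V>. ball x \<eta> \<subseteq> C"
    by (rule Heine_Borel_lemma[OF cpt]) (assumption, (rule that; (assumption | simp only:)))
  define c where "c = card H"
  have c: "c \<ge> 1" using H by (simp add: c_def Suc_leI card_gt_0_iff)
  \<comment> \<open>The three bounds serve the cover, the inclusion of levels in U, and the loss of
    at most |S|/(4c) elements when passing to interiors.\<close>
  define \<delta> where "\<delta> = min (min \<eta> \<rho>) (1 / (4 * real c))"
  have d: "\<delta> > 0" "\<delta> \<le> \<eta>" "\<delta> \<le> \<rho>" "\<delta> \<le> 1 / (4 * real c)" using eta \<rho> c by (auto simp: \<delta>_def)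
  \<comment> \<open>Invariance under L gives extendability; invariance under H keeps the levels
    moved into U within the tower.\<close>
  define M where "M = L \<union> H"
  have M: "finite M" "0 \<in> M" using L H by (auto simp: M_def)
  have c4: "4 * c \<ge> 1" using c by simp
  obtain I S V S' where tc: "tower_castle \<alpha> I S V" and op: "\<And>i. i \<in> I \<Longrightarrow> open (V i)"
    and inv: "\<And>i. i \<in> I \<Longrightarrow> (1 - \<delta>) * real (card (S i)) \<le> real (card {s. \<forall>t\<in>M. t + s \<in> S i})"
    and dst: "\<And>i s x y. i \<in> I \<Longrightarrow> s \<in> S i \<Longrightarrow> x \<in> \<alpha> s ` V i \<Longrightarrow> y \<in> \<alpha> s ` V i \<Longrightarrow> dist x y < \<delta>"
    and S': "\<And>i. i \<in> I \<Longrightarrow> S' i \<subseteq> S i"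
      "\<And>i. i \<in> I \<Longrightarrow> real (4 * c) * real (card (S' i)) < real (card (S i))"
    and rem: "act_subeq \<alpha> (UNIV - (\<Union>i\<in>I. \<Union>s\<in>S i. \<alpha> s ` V i)) (\<Union>i\<in>I. \<Union>s\<in>S' i. \<alpha> s ` V i)"
    by (rule almost_finiteE[OF af cpt c4 M d(1)]) (rule that; (assumption | simp only:))
  have finS: "finite (S i)" if "i \<in> I" for i using tc that unfolding tower_castle_def by simp
  define F where "F i = {s. \<forall>t\<in>M. t + s \<in> S i}" for i
  have FS: "F i \<subseteq> S i" for i using M(2) unfolding F_def by force
  define Q where "Q i = {s\<in>S i. \<alpha> s ` V i \<subseteq> U}" for i
  have QS: "Q i \<subseteq> S i" for i unfolding Q_def by blast
  \<comment> \<open>Each interior s is moved by some h in H to a level inside U. The pair of h and h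
    + s determines s, so this is at most |H|-to-one.\<close>
  have FQ: "card (F i) \<le> c * card (Q i)" if i: "i \<in> I" and ne: "V i \<noteq> {}" for i
  proof -
    obtain v where v: "v \<in> V i" using ne by blast
    have "\<forall>s. \<exists>h. h \<in> H \<and> \<alpha> (h + s) v \<in> ball x0 \<rho>"
      using hit unfolding act_add by (metis (no_types))
    then obtain h where h: "\<And>s. h s \<in> H" "\<And>s. \<alpha> (h s + s) v \<in> ball x0 \<rho>" by metis
    have "card (F i) \<le> card (H \<times> Q i)"
    proof (rule card_inj_on_le[of "\<lambda>s. (h s, h s + s)"])
      show "inj_on (\<lambda>s. (h s, h s + s)) (F i)" by (rule inj_onI) (metis add_left_cancel prod.inject)
      show "finite (H \<times> Q i)" using H(1) finite_subset[OF QS finS[OF i]] by simp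
      show "(\<lambda>s. (h s, h s + s)) ` F i \<subseteq> H \<times> Q i"
      proof (rule image_subsetI)
        fix s assume "s \<in> F i"
        then have sS: "h s + s \<in> S i" using h(1)[of s] unfolding F_def M_def by blast
        have "\<alpha> (h s + s) ` V i \<subseteq> U"
        proof
          fix y assume "y \<in> \<alpha> (h s + s) ` V i"
          then have "dist (\<alpha> (h s + s) v) y < \<rho>" using dst[OF i sS imageI[OF v]] d(3) by force
          moreover have "dist x0 (\<alpha> (h s + s) v) < \<rho>" using h(2)[of s] by simp
          ultimately have "dist x0 y < \<rho>'"
            using dist_triangle[of x0 y "\<alpha> (h s + s) v"] unfolding \<rho>_def by simp
          then show "y \<in> U" using \<rho>'(2) by auto
        qed
        then show "(h s, h s + s) \<in> H \<times> Q i" using h(1) sS unfolding Q_def by simp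
      qed
    qed
    then show ?thesis by (simp add: card_cartesian_product c_def)
  qed
  \<comment> \<open>Both \<open>S' i\<close> and the levels outside the interior are at most
    |S|/(4c) in number. The interior has at least 3|S|/4 elements, so \<open>FQ\<close> leaves ample
    room for their sum |S|/(2c) in \<open>Q i\<close>.\<close>
  have count: "card (S' i) + card (S i - F i) \<le> card (Q i)" if i: "i \<in> I" for i
  proof -
    have "real (card (S i)) - real (card (F i)) \<le> \<delta> * real (card (S i))"
      using inv[OF i] unfolding F_def by (simp add: algebra_simps)
    also have "\<dots> \<le> 1 / (4 * real c) * real (card (S i))" using d(4) by (intro mult_right_mono) simp_all
    finally have 1: "4 * real c * (real (card (S i)) - real (card (F i))) \<le> real (card (S i))"
      using c by (simp add: field_simps)
    have 2: "real (card (S i - F i)) = real (card (S i)) - real (card (F i))"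
      using card_Diff_subset[OF finite_subset[OF FS finS[OF i]] FS] card_mono[OF finS[OF i] FS] by (simp add: of_nat_diff)
    have 3: "4 * real c * (real (card (S' i)) + real (card (S i - F i))) \<le> 2 * real (card (S i))"
      using 1 S'(2)[OF i] unfolding 2 by (simp add: algebra_simps)
    define q where "q = real c * real (card (Q i))"
    have q: "q \<ge> 0" by (simp add: q_def)
    have 4: "real (card (S i)) \<le> 2 * q"
    proof (cases "V i = {}")
      \<comment> \<open>\<open>FQ\<close> needs a base point, but over an empty base every level
        lies in U trivially.\<close>
      case True
      then have "Q i = S i" unfolding Q_def by simp
      then have "real (card (S i)) \<le> q"
        using c mult_right_mono[of 1 "real c" "real (card (S i))"] by (simp add: q_def)
      then show ?thesis using q by linarith
    next
      case False
      define f where "f = real (card (S i)) - real (card (F i))"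
      have "1 * f \<le> real c * f"
        using c card_mono[OF finS[OF i] FS] unfolding f_def by (intro mult_right_mono) simp_all
      moreover have "4 * (real c * f) \<le> real (card (S i))" using 1 unfolding f_def by (simp add: mult.assoc)
      ultimately have "4 * f \<le> real (card (S i))" by linarith
      moreover have "real (card (F i)) \<le> q"
        using FQ[OF i False] unfolding q_def by (metis of_nat_le_iff of_nat_mult)
      ultimately show ?thesis using q unfolding f_def by argo
    qed
    have "4 * real c * (real (card (S' i)) + real (card (S i - F i))) \<le> 4 * q"
      using 3 4 by linarith
    also have "\<dots> = 4 * real c * real (card (Q i))" by (simp add: q_def)
    finally have "4 * real c * (real (card (S' i)) + real (card (S i - F i))) \<le> 4 * real c * real (card (Q i))" .
    then have "real (card (S' i)) + real (card (S i - F i)) \<le> real (card (Q i))"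
      using c by simp
    then show ?thesis by linarith
  qed
  have "\<forall>i\<in>I. \<exists>A. A \<subseteq> Q i \<and> card A = card (S' i)"
  proof
    fix i assume "i \<in> I"
    then have "card (S' i) \<le> card (Q i)" using count by force
    then show "\<exists>A. A \<subseteq> Q i \<and> card A = card (S' i)" by (meson obtain_subset_with_card_n)
  qed
  then obtain Q1 where Q1: "\<forall>i\<in>I. Q1 i \<subseteq> Q i \<and> card (Q1 i) = card (S' i)" by (rule bchoice[THEN exE])
  \<comment> \<open>\<open>Q i\<close> is split: \<open>Q1 i\<close> receives the remainder by way
    of \<open>S' i\<close>, and \<open>Q2 i\<close> the levels outside the interior.\<close>
  define Q2 where "Q2 i = Q i - Q1 i" for i
  have Q1S: "Q1 i \<subseteq> S i" and cQ1: "card (S' i) \<le> card (Q1 i)" if "i \<in> I" for i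
    using bspec[OF Q1 that] QS[of i] by auto
  have Q2S: "Q2 i \<subseteq> S i" for i using QS[of i] unfolding Q2_def by blast
  have cQ2: "card (S i - F i) \<le> card (Q2 i)" if "i \<in> I" for i
  proof -
    have "card (Q2 i) = card (Q i) - card (S' i)"
      using bspec[OF Q1 that] card_Diff_subset[of "Q1 i" "Q i"] finite_subset[OF Q1S finS] that
      unfolding Q2_def by simp
    then show ?thesis using count[OF that] by linarith
  qed
  have "act_subeq \<alpha> (\<Union>i\<in>I. \<Union>s\<in>S' i. \<alpha> s ` V i) (\<Union>i\<in>I. \<Union>s\<in>Q1 i. \<alpha> s ` V i)"
    by (rule act_subeq_tower_levels[OF tc op S'(1) Q1S cQ1])
  with rem have 1: "act_subeq \<alpha> (UNIV - (\<Union>i\<in>I. \<Union>s\<in>S i. \<alpha> s ` V i)) (\<Union>i\<in>I. \<Union>s\<in>Q1 i. \<alpha> s ` V i)"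
    by (rule act_subeq_trans)
  have 2: "act_subeq \<alpha> (\<Union>i\<in>I. \<Union>s\<in>S i - F i. \<alpha> s ` V i) (\<Union>i\<in>I. \<Union>s\<in>Q2 i. \<alpha> s ` V i)"
    by (rule act_subeq_tower_levels[OF tc op Diff_subset Q2S cQ2])
  have "(\<Union>i\<in>I. \<Union>s\<in>Q1 i. \<alpha> s ` V i) \<inter> (\<Union>i\<in>I. \<Union>s\<in>Q2 i. \<alpha> s ` V i) = {}"
  proof (rule ccontr)
    assume "(\<Union>i\<in>I. \<Union>s\<in>Q1 i. \<alpha> s ` V i) \<inter> (\<Union>i\<in>I. \<Union>s\<in>Q2 i. \<alpha> s ` V i) \<noteq> {}"
    then obtain z where z: "z \<in> (\<Union>i\<in>I. \<Union>s\<in>Q1 i. \<alpha> s ` V i)" "z \<in> (\<Union>i\<in>I. \<Union>s\<in>Q2 i. \<alpha> s ` V i)" by blast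
    from z(1) obtain i s x where a: "i \<in> I" "s \<in> Q1 i" "x \<in> V i" "z = \<alpha> s x" by blast
    from z(2) obtain j t y where b: "j \<in> I" "t \<in> Q2 j" "y \<in> V j" "z = \<alpha> t y" by blast
    have "s \<in> S i" "t \<in> S j" using a(2) b(2) Q1S[OF a(1)] Q2S[of j] by blast+
    then have "i = j" "s = t" using tower_castleD[OF tc a(1) b(1) _ _ a(3) b(3)] a(4) b(4) by metis+
    then show False using a(2) b(2) unfolding Q2_def by simp
  qed
  then have "act_subeq \<alpha> ((UNIV - (\<Union>i\<in>I. \<Union>s\<in>S i. \<alpha> s ` V i)) \<union> (\<Union>i\<in>I. \<Union>s\<in>S i - F i. \<alpha> s ` V i))
      ((\<Union>i\<in>I. \<Union>s\<in>Q1 i. \<alpha> s ` V i) \<union> (\<Union>i\<in>I. \<Union>s\<in>Q2 i. \<alpha> s ` V i))"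
    by (rule act_subeq_Un[OF 1 2])
  then have "act_subeq \<alpha> (UNIV - (\<Union>i\<in>I. \<Union>s\<in>F i. \<alpha> s ` V i)) U"
  proof (rule act_subeq_mono)
    show "UNIV - (\<Union>i\<in>I. \<Union>s\<in>F i. \<alpha> s ` V i) \<subseteq>
        (UNIV - (\<Union>i\<in>I. \<Union>s\<in>S i. \<alpha> s ` V i)) \<union> (\<Union>i\<in>I. \<Union>s\<in>S i - F i. \<alpha> s ` V i)"
    proof
      fix x assume x: "x \<in> UNIV - (\<Union>i\<in>I. \<Union>s\<in>F i. \<alpha> s ` V i)"
      show "x \<in> (UNIV - (\<Union>i\<in>I. \<Union>s\<in>S i. \<alpha> s ` V i)) \<union> (\<Union>i\<in>I. \<Union>s\<in>S i - F i. \<alpha> s ` V i)"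
      proof (cases "x \<in> (\<Union>i\<in>I. \<Union>s\<in>S i. \<alpha> s ` V i)")
        case True
        then obtain i s where ii: "i \<in> I" "s \<in> S i" "x \<in> \<alpha> s ` V i" by blast
        have "s \<notin> F i" using x tower_unionI[OF ii(1), of s F x \<alpha> V] ii(3) by blast
        then show ?thesis using tower_unionI[OF ii(1), of s "\<lambda>i. S i - F i" x \<alpha> V] ii(2,3) by simp
      qed simp
    qed
    have "(\<Union>i\<in>I. \<Union>s\<in>Q' i. \<alpha> s ` V i) \<subseteq> U" if "\<And>i. i \<in> I \<Longrightarrow> Q' i \<subseteq> Q i" for Q'
    proof (intro UN_least)
      fix i s assume "i \<in> I" "s \<in> Q' i"
      then have "s \<in> Q i" using that by blast
      then show "\<alpha> s ` V i \<subseteq> U" unfolding Q_def by simp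
    qed
    then show "(\<Union>i\<in>I. \<Union>s\<in>Q1 i. \<alpha> s ` V i) \<union> (\<Union>i\<in>I. \<Union>s\<in>Q2 i. \<alpha> s ` V i) \<subseteq> U"
      using Q1 by (intro Un_least) (simp_all add: Q2_def)
  qed
  then have sub: "gsubeq G (unit_emb (UNIV - (\<Union>i\<in>I. \<Union>s\<in>F i. \<alpha> s ` V i))) U'"
    unfolding U'eq by (rule act_subeq_imp_gsubeq)

  define e :: "'g \<Rightarrow> nat" where "e = to_nat_on UNIV"
  define dd where "dd = inv e"
  have de: "dd (e s) = s" for s
    unfolding dd_def e_def using inj_on_to_nat_on[OF cnt] by (rule inv_f_f)
  define D where "D l i j = tower_bisection (V l) (dd i) (dd j)" for l i j
  have tcF: "tower_castle \<alpha> I F V"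
    using tc FS by (rule tower_castle_subset)
  have oD: "open_castle G I (\<lambda>l. e ` S l) D"
    using open_castle_of_towers[OF tc op de] unfolding D_def .
  have oC: "open_castle G I (\<lambda>l. e ` F l) D"
    using open_castle_of_towers[OF tcF op de] unfolding D_def .
  have "gsetprod G K (castle_union I (\<lambda>l. e ` F l) D) \<subseteq> castle_union I (\<lambda>l. e ` S l) D"
  proof
    fix p assume a: "p \<in> gsetprod G K (castle_union I (\<lambda>l. e ` F l) D)"
    obtain z g x where p: "p = (z, g, x)" by (cases p)
    from a[unfolded p] obtain h k y where 1: "(z, h, y) \<in> K" "(y, k, x) \<in> castle_union I (\<lambda>l. e ` F l) D" "g = h + k"
      by (rule gsetprodE)
    \<comment> \<open>An arrow of K leaving level s has group element h in L, and h + s stays in the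
      full shape because s is interior.\<close>
    from 1(2) obtain l s t where l: "l \<in> I" "s \<in> F l" "t \<in> F l" "(y, k, x) \<in> tower_bisection (V l) s t"
      unfolding castle_union_def D_def by (auto simp: de)
    obtain v where v: "v \<in> V l" "y = \<alpha> s v" "k = s - t" "x = \<alpha> t v" using l(4) unfolding tower_bisection_def by blast
    have h: "h \<in> L" "z = \<alpha> h y" using 1(1) L(3) by auto
    have hs: "h + s \<in> S l" using l(2) h(1) unfolding F_def M_def by blast
    have tS: "t \<in> S l" using l(3) FS by blast
    have "z = \<alpha> (h + s) v" using h v by (simp add: act_add)
    moreover have "g = h + s - t" using 1(3) v by (simp add: add_diff_eq)
    ultimately have "p \<in> tower_bisection (V l) (h + s) t" using v p unfolding tower_bisection_def by simp
    then have "p \<in> D l (e (h + s)) (e t)" unfolding D_def de .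
    then show "p \<in> castle_union I (\<lambda>l. e ` S l) D"
      unfolding castle_union_def using l(1) hs tS by blast
  qed
  then have ext: "extendable G K I (\<lambda>l. e ` F l) D (\<lambda>l. e ` S l) D"
    unfolding extendable_def using FS by (simp add: image_mono)
  have lev: "\<exists>W\<in>\<V>. D l i i \<subseteq> W" if l: "l \<in> I" and i: "i \<in> e ` S l" for l i
  proof -
    obtain s where s: "s \<in> S l" "i = e s" using i by blast
    have Dl: "D l i i = unit_emb (\<alpha> s ` V l)" unfolding D_def s de tower_bisection_diag ..
    \<comment> \<open>An empty level fits into any member of the cover; \<open>x0\<close> merely
      selects one.\<close>
    define x where "x = (if V l = {} then x0 else \<alpha> s (SOME v. v \<in> V l))"
    obtain W where W: "W \<in> \<V>" "ball x \<eta> \<subseteq> ?u W" using leb[of x] by blast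
    have "\<alpha> s ` V l \<subseteq> ball x \<eta>"
    proof
      fix y assume y: "y \<in> \<alpha> s ` V l"
      then have "V l \<noteq> {}" by blast
      then have "x \<in> \<alpha> s ` V l" unfolding x_def by (simp add: some_in_eq)
      then have "dist x y < \<delta>" using dst[OF l s(1)] y by blast
      then show "y \<in> ball x \<eta>" using d(2) by simp
    qed
    then have "D l i i \<subseteq> W" using W(2) unfolding Dl unit_emb_def by blast
    then show ?thesis using W(1) by blast
  qed
  have "castle_levels I (\<lambda>l. e ` F l) D = unit_emb (\<Union>i\<in>I. \<Union>s\<in>F i. \<alpha> s ` V i)"
    unfolding castle_levels_def D_def tower_bisection_diag by (simp add: unit_emb_def image_UN de)
  then have "gunits G - castle_levels I (\<lambda>l. e ` F l) D = unit_emb (UNIV - (\<Union>i\<in>I. \<Union>s\<in>F i. \<alpha> s ` V i))"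
    unfolding gunits_eq unit_emb_def by (simp only:) (rule image_set_diff[symmetric], simp add: inj_on_def)
  then have "gsubeq G (gunits G - castle_levels I (\<lambda>l. e ` F l) D) U'" using sub by simp
  then show "\<exists>I F C E D. open_castle G I F C \<and> open_castle G I E D \<and> extendable G K I F C E D \<and>
      (\<forall>l\<in>I. \<forall>i\<in>E l. \<exists>V\<in>\<V>. D l i i \<subseteq> V) \<and> gsubeq G (gunits G - castle_levels I F C) U'"
    using oC oD ext lev
    by (intro exI[of _ I] exI[of _ "\<lambda>l. e ` F l"] exI[of _ D] exI[of _ "\<lambda>l. e ` S l"] conjI ballI)
qed

end

theorem theorem6p6:
  fixes \<alpha> :: "'g::group_add \<Rightarrow> 'x::metric_space \<Rightarrow> 'x"
  assumes "countable (UNIV :: 'g set)"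
    and "amenable_group TYPE('g)"
    and "compact (UNIV :: 'x set)"
    and "group_action \<alpha>"
    and "minimal_action \<alpha>"
    and "free_action \<alpha>"
  shows "fiberwise_amenable (transformation_groupoid \<alpha>) \<and> almost_elementary (transformation_groupoid \<alpha>)
         \<longleftrightarrow> almost_finite \<alpha>"
proof -
  interpret top_action \<alpha> using assms(4) by unfold_locales
  show ?thesis
  proof
    assume "fiberwise_amenable (transformation_groupoid \<alpha>) \<and> almost_elementary (transformation_groupoid \<alpha>)"
    then show "almost_finite \<alpha>"
      \<comment> \<open>The case distinction between finite and infinite \<Gamma> takes place inside
        this call.\<close>
      using almost_elementary_imp_almost_finite fiberwise_amenable_imp_folner almost_finite_of_finite_group assms
      by blast
  next
    assume "almost_finite \<alpha>"
    then show "fiberwise_amenable (transformation_groupoid \<alpha>) \<and> almost_elementary (transformation_groupoid \<alpha>)"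
      using almost_finite_imp_fiberwise_amenable almost_finite_imp_almost_elementary assms by blast
  qed
qed

end
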